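(* Let $1\le p\le2$, let $f\in H^p_{\mathrm{slice}}(\mathbb{R}^{n+1}_+)$ and let $I\in\mathbb{S}$. Then for every $\mathbf{x}\in\mathbb{R}^{n+1}_+$, $$f(\mathbf{x})=\int_{\mathbb{R}}\mathscr{K}_{\mathbb{R}^{n+1}_+}(\mathbf{x},I\xi)\,f(I\xi)\,d\xi,$$ where $f(I\xi)$ is the non-tangential boundary limit of $f$ at $I\xi$.
   Context: $\mathbb{R}_n$ is the real Clifford algebra generated by $\mathbf{e}_1,\dots,\mathbf{e}_n$ with $\mathbf{e}_r\mathbf{e}_s+\mathbf{e}_s\mathbf{e}_r=-2\delta_{rs}$; its elements are $a=\sum_A a_A\mathbf{e}_A$ ($a_A\in\mathbb{R}$, $A\subseteq\{1,\dots,n\}$ ordered, $\mathbf{e}_A$ the corresponding ordered product, $\mathbf{e}_\varnothing=1$), with norm $|a|=(\sum_A a_A^2)^{1/2}$. $\mathbb{R}^{n+1}$ is identified with the set of paravectors $x_0+x_1\mathbf{e}_1+\dots+x_n\mathbf{e}_n$. $\mathbb{S}=\{x_1\mathbf{e}_1+\dots+x_n\mathbf{e}_n:\ x_1^2+\dots+x_n^2=1\}$, so $I^2=-1$ for $I\in\mathbb{S}$; $L_I=\mathbb{R}+I\mathbb{R}\cong\mathbb{C}$. For $U\subseteq\mathbb{R}^{n+1}$ open, a real differentiable $f:U\to\mathbb{R}_n$ is left slice monogenic, written $f\in\mathcal{SM}_l(U)$, if for every $I\in\mathbb{S}$, $\frac12\left(\frac{\partial}{\partial u}+I\frac{\partial}{\partial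 v}\right)f(u+Iv)=0$ on $U\cap L_I$. $\mathbb{R}^{n+1}_+=\{u+Iv:\ u>0,\ v\in\mathbb{R},\ I\in\mathbb{S}\}$ and $\Pi_{+,I}=\mathbb{R}^{n+1}_+\cap L_I$. For $1\le p\le2$, $H^p_{\mathrm{slice}}(\mathbb{R}^{n+1}_+)$ is the space of functions $f\in\mathcal{SM}_l(\mathbb{R}^{n+1}_+)$ such that $\sup_{I\in\mathbb{S}}\int_{\mathbb{R}}|f(Iv)|^p\,dv<\infty$, where $f(Iv)$ denotes the non-tangential boundary limit (taken within $\Pi_{+,I}$) of $f$ at $Iv$, for almost every $v\in\mathbb{R}$. Kernel: for $I\in\mathbb{S}$ put $\mathscr{K}_{\Pi_{+,I}}(u+Iv,\xi+I\eta)=\frac1{2\pi}\int_{-\infty}^0e^{[(u+Iv)+(\xi-I\eta)]w}\,dw$. $\mathscr{K}_{\mathbb{R}^{n+1}_+}(\cdot,\xi+I\eta)$ is its left slice monogenic extension in the first variable to $\mathbb{R}^{n+1}_+$, where the extension of $h$ from $\Pi_{+,I}$ is $h(u+Jv)=\frac12[h(u-Iv)+h(u+Iv)]+\frac{JI}{2}[h(u-Iv)-h(u+Iv)]$, $J\in\mathbb{S}$. Explicitly, $\mathscr{K}_{\mathbb{R}^{n+1}_+}(\mathbf{x},\xi+I\eta)=\frac1{2\pi}\int_{-\infty}^0e^{\mathbf{x}w}e^{(\xi-I\eta)w}\,dw$, so that $\mathscr{K}_{\mathbb{R}^{n+1}_+}(\mathbf{x},I\xi)=\frac1{2\pi}\int_{-\infty}^0e^{\mathbf{x}w}e^{-I\xi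 w}\,dw$ for real $\xi$.
   Formalization: The Hardy space additionally requires, for every I, that the integrals of |f(u+Iv)|^p over v be bounded uniformly in u>0; with boundary integrability alone the claim fails, e.g. for f(x)=e^x(1+x)^{-2}. *)

theory Defs
  imports "HOL-Analysis.Analysis"
begin

text \<open>
  The generators are indexed by a finite linearly ordered type \<open>'n\<close>, so \<open>n = CARD('n) \<ge> 1\<close>;
  an element is the family of its ccoefficients \<open>a\<^sub>A\<close> with respect to the products \<open>e\<^sub>A\<close>.
\<close>

typedef 'n clifford = "UNIV :: ('n set \<Rightarrow> real) set"
  morphisms ccoeff Clifford by simp

lemma ccoeff_Clifford [simp]: "ccoeff (Clifford a) A = a A"
  by (simp add: Clifford_inverse)

lemma clifford_eqI: "(\<And>A. ccoeff a A = ccoeff b A) \<Longrightarrow> a = b"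
  by (metis ccoeff_inject ext)

instantiation clifford :: (type) real_vector
begin

definition "0 = Clifford (\<lambda>A. 0)"
definition "a + b = Clifford (\<lambda>A. ccoeff a A + ccoeff b A)"
definition "- a = Clifford (\<lambda>A. - ccoeff a A)"
definition "a - b = Clifford (\<lambda>A. ccoeff a A - ccoeff b A)"
definition "r *\<^sub>R a = Clifford (\<lambda>A. r * ccoeff a A)"

instance
  by standard
    (auto intro!: clifford_eqI simp: zero_clifford_def plus_clifford_def uminus_clifford_def
      minus_clifford_def scaleR_clifford_def algebra_simps)

end

lemma ccoeff_zero [simp]: "ccoeff 0 A = 0"
  and ccoeff_add [simp]: "ccoeff (a + b) A = ccoeff a A + ccoeff b A"
  and ccoeff_uminus [simp]: "ccoeff (- a) A = - ccoeff a A"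
  and ccoeff_diff [simp]: "ccoeff (a - b) A = ccoeff a A - ccoeff b A"
  and ccoeff_scaleR [simp]: "ccoeff (r *\<^sub>R a) A = r * ccoeff a A"
  by (simp_all add: zero_clifford_def plus_clifford_def uminus_clifford_def
      minus_clifford_def scaleR_clifford_def)

lemma ccoeff_sum [simp]: "ccoeff (sum f S) A = (\<Sum>i\<in>S. ccoeff (f i) A)"
  by (induction S rule: infinite_finite_induct) auto

definition blade :: "'n set \<Rightarrow> 'n clifford" where
  "blade A = Clifford (\<lambda>B. if B = A then 1 else 0)"

lemma ccoeff_blade [simp]: "ccoeff (blade A) B = (if B = A then 1 else 0)"
  by (simp add: blade_def)

lemma clifford_expansion: "a = (\<Sum>A\<in>UNIV. ccoeff a A *\<^sub>R blade A)" for a :: "'n::finite clifford"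
  by (rule clifford_eqI) (simp add: if_distrib [of "\<lambda>x. _ * x"] cong: if_cong)

instantiation clifford :: (finite) euclidean_space
begin

definition "inner a b = (\<Sum>A\<in>UNIV. ccoeff a A * ccoeff b A)"
definition "norm a = sqrt (\<Sum>A\<in>UNIV. (ccoeff a A)\<^sup>2)" for a :: "'a clifford"
definition "dist a b = norm (a - b)" for a b :: "'a clifford"
definition "sgn a = a /\<^sub>R norm a" for a :: "'a clifford"
definition "(uniformity :: ('a clifford \<times> 'a clifford) filter)
  = (INF e\<in>{0 <..}. principal {(x, y). dist x y < e})"
definition "open U = (\<forall>x\<in>U. \<forall>\<^sub>F (x', y) in uniformity. x' = x \<longrightarrow> y \<in> U)"
  for U :: "'a clifford set"
definition "Basis = range (blade :: 'a set \<Rightarrow> 'a clifford)"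

instance
proof
  fix a b c :: "'a clifford" and r :: real and U :: "'a clifford set"
  show "dist a b = norm (a - b)"
    by (rule dist_clifford_def)
  show "sgn a = a /\<^sub>R norm a"
    by (rule sgn_clifford_def)
  show "(uniformity :: ('a clifford \<times> 'a clifford) filter)
      = (INF e\<in>{0 <..}. principal {(x, y). dist x y < e})"
    by (rule uniformity_clifford_def)
  show "open U = (\<forall>x\<in>U. \<forall>\<^sub>F (x', y) in uniformity. x' = x \<longrightarrow> y \<in> U)"
    by (rule open_clifford_def)
  show "inner a b = inner b a"
    by (simp add: inner_clifford_def mult.commute)
  show "inner (a + b) c = inner a c + inner b c"
    by (simp add: inner_clifford_def distrib_right sum.distrib)
  show "inner (r *\<^sub>R a) b = r * inner a b"
    by (simp add: inner_clifford_def sum_distrib_left mult.assoc)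
  show "0 \<le> inner a a"
    by (simp add: inner_clifford_def sum_nonneg)
  show "inner a a = 0 \<longleftrightarrow> a = 0"
    by (auto simp: inner_clifford_def sum_nonneg_eq_0_iff intro: clifford_eqI)
  show "norm a = sqrt (inner a a)"
    by (simp add: inner_clifford_def norm_clifford_def power2_eq_square)
  show "(Basis :: 'a clifford set) \<noteq> {}" "finite (Basis :: 'a clifford set)"
    by (auto simp: Basis_clifford_def)
  show "inner a b = (if a = b then 1 else 0)" if "a \<in> Basis" "b \<in> Basis"
  proof -
    obtain A B where "a = blade A" "b = blade B"
      using \<open>a \<in> Basis\<close> \<open>b \<in> Basis\<close> by (auto simp: Basis_clifford_def)
    moreover have "blade A = blade B \<longleftrightarrow> A = B"
      by (metis ccoeff_blade zero_neq_one)
    ultimately show ?thesis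
      by (cases "A = B")
        (auto simp: inner_clifford_def if_distrib [of "\<lambda>x. x * _"] intro!: sum.neutral cong: if_cong)
  qed
  show "(\<forall>u\<in>Basis. inner a u = 0) \<longleftrightarrow> a = 0"
    by (auto simp: Basis_clifford_def inner_clifford_def if_distrib [of "\<lambda>x. _ * x"]
        intro: clifford_eqI cong: if_cong)
qed

end

text \<open>
  Sorting the concatenation of the ordered products \<open>e\<^sub>A\<close> and \<open>e\<^sub>B\<close> costs one sign for every pair
  \<open>i \<in> A\<close>, \<open>j \<in> B\<close> with \<open>j < i\<close> (anticommutation) and one for every common index
  (\<open>e\<^sub>i\<^sup>2 = -1\<close>), so \<open>e\<^sub>A e\<^sub>B = \<plusminus>e\<^sub>C\<close> where \<open>C\<close> is the symmetric difference of \<open>A\<close> and \<open>B\<close>;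
  equivalently \<open>B\<close> is the symmetric difference of \<open>A\<close> and \<open>C\<close>.
\<close>

definition blade_sign :: "'n::linorder set \<Rightarrow> 'n set \<Rightarrow> real" where
  "blade_sign A B = (-1) ^ card {(i, j). i \<in> A \<and> j \<in> B \<and> j \<le> i}"

lemma blade_sign_prod:
  fixes A B :: "'n::{finite,linorder} set"
  shows "blade_sign A B = (\<Prod>i\<in>A. \<Prod>j\<in>B. if j \<le> i then -1 else 1)"
proof -
  have "(\<Prod>i\<in>A. \<Prod>j\<in>B. if j \<le> i then -1 else (1::real))
      = (\<Prod>(i, j)\<in>A \<times> B. if j \<le> i then -1 else 1)"
    by (simp add: prod.cartesian_product)
  also have "\<dots> = (\<Prod>(i, j)\<in>{(i, j). i \<in> A \<and> j \<in> B \<and> j \<le> i}. -1)"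
    by (rule prod.mono_neutral_cong_right) (auto split: if_splits)
  finally show ?thesis
    by (simp add: blade_sign_def case_prod_unfold)
qed

lemma prod_sym_diff:
  fixes g :: "'n::finite \<Rightarrow> real"
  assumes "\<And>i. g i * g i = 1"
  shows "prod g (sym_diff A B) = prod g A * prod g B"
proof -
  have 1: "prod g A = prod g (A - B) * prod g (A \<inter> B)"
    by (metis finite Diff_Diff_Int Diff_subset prod.subset_diff mult.commute Int_lower1)
  have 2: "prod g B = prod g (B - A) * prod g (A \<inter> B)"
    by (metis finite Int_commute Diff_Diff_Int Diff_subset prod.subset_diff mult.commute)
  have 3: "prod g (A \<inter> B) * prod g (A \<inter> B) = 1"
    by (simp add: prod.distrib [symmetric] assms)
  have "prod g (sym_diff A B) = prod g (A - B) * prod g (B - A)"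
    by (rule prod.union_disjoint) auto
  also have "\<dots> = prod g (A - B) * prod g (B - A) * (prod g (A \<inter> B) * prod g (A \<inter> B))"
    by (simp only: 3 mult_1_right)
  also have "\<dots> = prod g A * prod g B"
    unfolding 1 2 by (simp only: ac_simps)
  finally show ?thesis .
qed

lemma blade_sign_sym_diff_left:
  fixes A B C :: "'n::{finite,linorder} set"
  shows "blade_sign (sym_diff A B) C = blade_sign A C * blade_sign B C"
  unfolding blade_sign_prod by (rule prod_sym_diff)
    (unfold prod.distrib [symmetric], rule prod.neutral, simp)

lemma blade_sign_sym_diff_right:
  fixes A B C :: "'n::{finite,linorder} set"
  shows "blade_sign A (sym_diff B C) = blade_sign A B * blade_sign A C"
  unfolding blade_sign_prod prod.distrib [symmetric]
  by (intro prod.cong refl prod_sym_diff) auto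

lemma sym_diff_assoc: "sym_diff (sym_diff A B) C = sym_diff A (sym_diff B C)"
  by blast

lemma sym_diff_cancel [simp]: "sym_diff A (sym_diff A B) = B"
  by blast

instantiation clifford :: ("{finite,linorder}") real_algebra_1
begin

definition "1 = (blade {} :: 'a clifford)"
definition "a * b = Clifford (\<lambda>C. \<Sum>A\<in>UNIV.
  blade_sign A (sym_diff A C) * ccoeff a A * ccoeff b (sym_diff A C))" for a b :: "'a clifford"

instance
proof
  fix a b c :: "'a clifford" and r :: real
  show "a * b * c = a * (b * c)"
  proof (rule clifford_eqI)
    fix D :: "'a set"
    have "ccoeff (a * b * c) D = (\<Sum>E\<in>UNIV. \<Sum>A\<in>UNIV. blade_sign E (sym_diff E D)
        * blade_sign A (sym_diff A E) * ccoeff a A * ccoeff b (sym_diff A E) * ccoeff c (sym_diff E D))"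
      by (simp add: times_clifford_def sum_distrib_left sum_distrib_right mult.assoc)
    also have "\<dots> = (\<Sum>A\<in>UNIV. \<Sum>E\<in>UNIV. blade_sign E (sym_diff E D)
        * blade_sign A (sym_diff A E) * ccoeff a A * ccoeff b (sym_diff A E) * ccoeff c (sym_diff E D))"
      by (rule sum.swap)
    also have "\<dots> = (\<Sum>A\<in>UNIV. \<Sum>B\<in>UNIV. blade_sign A (sym_diff A D)
        * blade_sign B (sym_diff B (sym_diff A D)) * ccoeff a A * ccoeff b B
        * ccoeff c (sym_diff B (sym_diff A D)))"
    proof (rule sum.cong [OF refl])
      fix A :: "'a set"
      show "(\<Sum>E\<in>UNIV. blade_sign E (sym_diff E D) * blade_sign A (sym_diff A E) * ccoeff a A
            * ccoeff b (sym_diff A E) * ccoeff c (sym_diff E D))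
          = (\<Sum>B\<in>UNIV. blade_sign A (sym_diff A D) * blade_sign B (sym_diff B (sym_diff A D))
            * ccoeff a A * ccoeff b B * ccoeff c (sym_diff B (sym_diff A D)))"
      proof (rule sum.reindex_bij_witness [where i = "sym_diff A" and j = "sym_diff A"])
        fix E :: "'a set"
        show "blade_sign A (sym_diff A D)
              * blade_sign (sym_diff A E) (sym_diff (sym_diff A E) (sym_diff A D))
              * ccoeff a A * ccoeff b (sym_diff A E)
              * ccoeff c (sym_diff (sym_diff A E) (sym_diff A D))
            = blade_sign E (sym_diff E D) * blade_sign A (sym_diff A E) * ccoeff a A
              * ccoeff b (sym_diff A E) * ccoeff c (sym_diff E D)"
        proof -
          have e: "sym_diff (sym_diff A E) (sym_diff A D) = sym_diff E D"
            by blast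
          have "blade_sign A D * blade_sign A D = 1"
            by (simp add: blade_sign_def flip: power_add)
          then show ?thesis
            unfolding e blade_sign_sym_diff_left blade_sign_sym_diff_right
            by algebra
        qed
      qed (auto; blast)+
    qed
    also have "\<dots> = ccoeff (a * (b * c)) D"
      by (simp add: times_clifford_def sum_distrib_left sum_distrib_right mult_ac)
    finally show "ccoeff (a * b * c) D = ccoeff (a * (b * c)) D" .
  qed
  show "1 * a = a"
    by (rule clifford_eqI)
      (simp add: times_clifford_def one_clifford_def blade_sign_def if_distrib [of "\<lambda>x. x * _"]
        if_distrib [of "\<lambda>x. _ * x"] cong: if_cong)
  show "a * 1 = a"
  proof (rule clifford_eqI)
    fix C
    have "sym_diff A C = {} \<longleftrightarrow> A = C" for A :: "'a set"
      by blast
    then show "ccoeff (a * 1) C = ccoeff a C"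
      by (simp add: times_clifford_def one_clifford_def blade_sign_def if_distrib [of "\<lambda>x. x * _"]
        if_distrib [of "\<lambda>x. _ * x"] cong: if_cong)
  qed
  show "(a + b) * c = a * c + b * c" "a * (b + c) = a * b + a * c"
    by (auto intro!: clifford_eqI simp: times_clifford_def algebra_simps sum.distrib)
  show "r *\<^sub>R a * b = r *\<^sub>R (a * b)" "a * r *\<^sub>R b = r *\<^sub>R (a * b)"
    by (auto intro!: clifford_eqI simp: times_clifford_def sum_distrib_left mult_ac)
  show "(0 :: 'a clifford) \<noteq> 1"
    by (metis ccoeff_blade ccoeff_zero one_clifford_def zero_neq_one)
qed

end

lemma blade_mult:
  fixes A B :: "'n::{finite,linorder} set"
  shows "blade A * blade B = blade_sign A B *\<^sub>R blade (sym_diff A B)"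
proof (rule clifford_eqI)
  fix C
  have "ccoeff (blade A * blade B) C
      = (\<Sum>X\<in>UNIV. if X = A then blade_sign A (sym_diff A C) * ccoeff (blade B) (sym_diff A C) else 0)"
    unfolding times_clifford_def ccoeff_Clifford by (rule sum.cong) auto
  also have "\<dots> = blade_sign A (sym_diff A C) * ccoeff (blade B) (sym_diff A C)"
    by simp
  also have "sym_diff A C = B \<longleftrightarrow> C = sym_diff A B"
    by blast
  then have "blade_sign A (sym_diff A C) * ccoeff (blade B) (sym_diff A C)
      = ccoeff (blade_sign A B *\<^sub>R blade (sym_diff A B)) C"
    unfolding ccoeff_scaleR ccoeff_blade by (cases "C = sym_diff A B") simp_all
  finally show "ccoeff (blade A * blade B) C = ccoeff (blade_sign A B *\<^sub>R blade (sym_diff A B)) C" .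
qed

definition gen :: "'n \<Rightarrow> 'n clifford" where
  "gen i = blade {i}"

lemma gen_anticommute:
  fixes r s :: "'n::{finite,linorder}"
  shows "gen r * gen s + gen s * gen r = (if r = s then -2 else 0)"
proof -
  have *: "{(i, j). i \<in> {a} \<and> j \<in> {b} \<and> j \<le> i} = (if b \<le> a then {(a, b)} else {})" for a b :: 'n
    by auto
  have c: "insert r {s} = insert s {r}" by auto
  have m2: "(-2 :: 'n clifford) = (-1) *\<^sub>R 1 + (-1) *\<^sub>R 1"
    by simp
  show ?thesis
  proof (cases "r = s")
    case True
    then show ?thesis
      unfolding gen_def blade_mult blade_sign_def * m2 one_clifford_def by simp
  next
    case False
    then have "sym_diff {r} {s} = {r, s}" "sym_diff {s} {r} = {r, s}"
      by auto
    then show ?thesis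
      using False
      unfolding gen_def blade_mult blade_sign_def * by (cases r s rule: linorder_cases) auto
  qed
qed

lemma blade_eq_prod_list:
  fixes A :: "'n::{finite,linorder} set"
  shows "blade A = prod_list (map gen (sorted_list_of_set A))"
proof -
  have "finite A" by simp
  then show ?thesis
  proof (induction A rule: finite_linorder_min_induct)
    case empty
    then show ?case by (simp add: one_clifford_def)
  next
    case (insert b A)
    have "{(i, j). i \<in> {b} \<and> j \<in> A \<and> j \<le> i} = {}"
      using insert.hyps by auto
    then have "blade_sign {b} A = 1"
      unfolding blade_sign_def by (simp only: card.empty power_0)
    moreover have "sym_diff {b} A = insert b A"
      using insert.hyps by auto
    ultimately have "blade (insert b A) = gen b * blade A"
      unfolding gen_def blade_mult by (simp only: scaleR_one)
    moreover have "sorted_list_of_set (insert b A) = b # sorted_list_of_set A"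
      using insert.hyps
      by (subst sorted_list_of_set_insert) (auto simp: insort_is_Cons less_imp_le)
    ultimately show ?case
      using insert.IH by simp
  qed
qed


definition paravectors :: "'n::{finite,linorder} clifford set" where
  "paravectors = {of_real x0 + (\<Sum>i\<in>UNIV. x i *\<^sub>R gen i) | x0 x. True}"

definition unit_sphere :: "'n::{finite,linorder} clifford set" where
  "unit_sphere = {\<Sum>i\<in>UNIV. x i *\<^sub>R gen i | x. (\<Sum>i\<in>UNIV. (x i)\<^sup>2) = 1}"

definition slice_point :: "'n::{finite,linorder} clifford \<Rightarrow> real \<Rightarrow> real \<Rightarrow> 'n clifford" where
  "slice_point I u v = of_real u + v *\<^sub>R I"

definition half_space :: "'n::{finite,linorder} clifford set" where
  "half_space = {slice_point I u v | I u v. I \<in> unit_sphere \<and> 0 < u}"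

lemma ccoeff_gen: "ccoeff (gen i) A = (if A = {i} then 1 else 0)"
  by (simp add: gen_def)

lemma ccoeff_of_real [simp]:
  "ccoeff (of_real r :: 'n::{finite,linorder} clifford) A = (if A = {} then r else 0)"
  by (simp add: of_real_def one_clifford_def)

lemma gen_sum_square:
  fixes x :: "'n::{finite,linorder} \<Rightarrow> real"
  shows "(\<Sum>i\<in>UNIV. x i *\<^sub>R gen i) * (\<Sum>i\<in>UNIV. x i *\<^sub>R gen i) = of_real (- (\<Sum>i\<in>UNIV. (x i)\<^sup>2))"
    (is "?y * ?y = _")
proof -
  have 1: "?y * ?y = (\<Sum>i\<in>UNIV. \<Sum>j\<in>UNIV. (x i * x j) *\<^sub>R (gen i * gen j))"
    by (simp add: sum_product mult.commute)
  also have "\<dots> = (\<Sum>i\<in>UNIV. \<Sum>j\<in>UNIV. (x i * x j) *\<^sub>R (gen j * gen i))"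
    by (subst sum.swap) (simp add: mult.commute)
  finally have "?y * ?y + ?y * ?y
      = (\<Sum>i\<in>UNIV. \<Sum>j\<in>UNIV. (x i * x j) *\<^sub>R (gen i * gen j + gen j * gen i))"
    by (simp add: 1 scaleR_add_right sum.distrib)
  also have "\<dots> = (\<Sum>i\<in>UNIV. \<Sum>j\<in>UNIV. if i = j then (x i * x j) *\<^sub>R (-2) else 0)"
    unfolding gen_anticommute by (intro sum.cong refl) auto
  also have "\<dots> = (\<Sum>i\<in>UNIV. (x i)\<^sup>2 *\<^sub>R (-2))"
    by (simp add: power2_eq_square)
  also have "\<dots> = 2 *\<^sub>R of_real (- (\<Sum>i\<in>UNIV. (x i)\<^sup>2))"
    unfolding scaleR_sum_left [symmetric] by (simp add: scaleR_conv_of_real mult_2 mult_2_right)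
  finally have "2 *\<^sub>R (?y * ?y) = 2 *\<^sub>R of_real (- (\<Sum>i\<in>UNIV. (x i)\<^sup>2))"
    by (simp only: scaleR_2)
  then show ?thesis
    by (simp only: scaleR_cancel_left) simp
qed

lemma unit_sphere_square:
  assumes "I \<in> unit_sphere"
  shows "I * I = -1"
  using assms by (auto simp: unit_sphere_def gen_sum_square)

lemma ccoeff_unit_sphere_empty:
  assumes "I \<in> unit_sphere"
  shows "ccoeff I {} = 0"
  using assms by (auto simp: unit_sphere_def ccoeff_gen)

lemma uminus_unit_sphere:
  assumes "I \<in> unit_sphere"
  shows "- I \<in> unit_sphere"
proof -
  obtain x where "I = (\<Sum>i\<in>UNIV. x i *\<^sub>R gen i)" "(\<Sum>i\<in>UNIV. (x i)\<^sup>2) = 1"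
    using assms by (auto simp: unit_sphere_def)
  then have "- I = (\<Sum>i\<in>UNIV. (- x i) *\<^sub>R gen i)" "(\<Sum>i\<in>UNIV. (- x i)\<^sup>2) = 1"
    by (simp_all add: sum_negf)
  then show ?thesis
    unfolding unit_sphere_def by (intro CollectI exI [of _ "\<lambda>i. - x i"] conjI)
qed

lemma gen_in_unit_sphere: "gen i \<in> unit_sphere"
  for i :: "'n::{finite,linorder}"
proof -
  have "gen i = (\<Sum>j\<in>UNIV. (if j = i then 1 else 0) *\<^sub>R gen j)"
    by (simp add: if_distrib [of "\<lambda>r. r *\<^sub>R _"] cong: if_cong)
  moreover have "(\<Sum>j\<in>UNIV. (if j = i then 1 else 0 :: real)\<^sup>2) = 1"
    by (simp add: if_distrib [of "\<lambda>r. r\<^sup>2"] cong: if_cong)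
  ultimately show ?thesis
    unfolding unit_sphere_def by (intro CollectI exI conjI)
qed

lemma half_space_eq:
  "(half_space :: 'n::{finite,linorder} clifford set) = {x \<in> paravectors. 0 < ccoeff x {}}"
proof (intro set_eqI iffI)
  fix x :: "'n clifford"
  assume "x \<in> half_space"
  then obtain I u v where x: "x = slice_point I u v" "I \<in> unit_sphere" "0 < u"
    by (auto simp: half_space_def)
  then obtain y where y: "I = (\<Sum>i\<in>UNIV. y i *\<^sub>R gen i)"
    by (auto simp: unit_sphere_def)
  have "x = of_real u + (\<Sum>i\<in>UNIV. (v * y i) *\<^sub>R gen i)"
    by (simp add: x slice_point_def y scaleR_sum_right)
  moreover have "0 < ccoeff x {}"
    using x by (simp add: slice_point_def ccoeff_unit_sphere_empty)
  ultimately show "x \<in> {x \<in> paravectors. 0 < ccoeff x {}}"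
    by (auto simp: paravectors_def)
next
  fix x :: "'n clifford"
  assume "x \<in> {x \<in> paravectors. 0 < ccoeff x {}}"
  then obtain x0 y where x: "x = of_real x0 + (\<Sum>i\<in>UNIV. y i *\<^sub>R gen i)" and "0 < ccoeff x {}"
    by (auto simp: paravectors_def)
  then have "0 < x0"
    by (simp add: ccoeff_gen)
  define r where "r = sqrt (\<Sum>i\<in>UNIV. (y i)\<^sup>2)"
  show "x \<in> half_space"
  proof (cases "r = 0")
    case True
    then have "\<And>i. y i = 0"
      by (simp add: r_def sum_nonneg_eq_0_iff)
    then have "x = slice_point (gen undefined) x0 0"
      by (simp add: x slice_point_def)
    then show ?thesis
      using \<open>0 < x0\<close> gen_in_unit_sphere unfolding half_space_def by blast
  next
    case False
    have "(\<Sum>i\<in>UNIV. (y i)\<^sup>2) = r\<^sup>2"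
      by (simp add: r_def sum_nonneg)
    then have "(\<Sum>i\<in>UNIV. (y i / r)\<^sup>2) = 1"
      using False by (simp add: power_divide flip: sum_divide_distrib)
    then have "(\<Sum>i\<in>UNIV. (y i / r) *\<^sub>R gen i) \<in> unit_sphere"
      unfolding unit_sphere_def by (intro CollectI exI [of _ "\<lambda>i. y i / r"] conjI refl)
    moreover have "x = slice_point (\<Sum>i\<in>UNIV. (y i / r) *\<^sub>R gen i) x0 r"
      using False by (simp add: x slice_point_def scaleR_sum_right)
    ultimately show ?thesis
      using \<open>0 < x0\<close> unfolding half_space_def by blast
  qed
qed

lemma openin_half_space:
  "openin (top_of_set paravectors) (half_space :: 'n::{finite,linorder} clifford set)"
proof -
  have "ccoeff x {} = inner (blade {}) x" for x :: "'n clifford"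
    by (simp add: inner_clifford_def if_distrib [of "\<lambda>r. r * _"] cong: if_cong)
  then have "open {x :: 'n clifford. 0 < ccoeff x {}}"
    by (simp add: open_Collect_less continuous_on_const continuous_on_inner continuous_on_id)
  then show ?thesis
    by (auto simp: half_space_eq openin_open)
qed

lemma slice_point_eq_iff:
  fixes I J :: "'n::{finite,linorder} clifford"
  assumes "I \<in> unit_sphere" "J \<in> unit_sphere"
  shows "slice_point I u v = slice_point J u' v'
    \<longleftrightarrow> u = u' \<and> (v = 0 \<and> v' = 0 \<or> v = v' \<and> I = J \<or> v = - v' \<and> I = - J)"
proof
  assume eq: "slice_point I u v = slice_point J u' v'"
  then have "ccoeff (slice_point I u v) {} = ccoeff (slice_point J u' v') {}"
    by simp
  then have u: "u = u'"
    using assms by (simp add: slice_point_def ccoeff_unit_sphere_empty)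
  then have vec: "v *\<^sub>R I = v' *\<^sub>R J"
    using eq by (simp add: slice_point_def)
  have "(v *\<^sub>R I) * (v *\<^sub>R I) = (v' *\<^sub>R J) * (v' *\<^sub>R J)"
    by (simp only: vec)
  then have "ccoeff (of_real (v * v) :: 'n clifford) {} = ccoeff (of_real (v' * v') :: 'n clifford) {}"
    using assms by (simp add: unit_sphere_square of_real_def)
  then have "v = v' \<or> v = - v'"
    unfolding ccoeff_of_real by (simp add: square_eq_iff)
  then show "u = u' \<and> (v = 0 \<and> v' = 0 \<or> v = v' \<and> I = J \<or> v = - v' \<and> I = - J)"
  proof
    assume "v = v'"
    then show ?thesis using vec u by auto
  next
    assume "v = - v'"
    then have "v' *\<^sub>R J = - (v' *\<^sub>R I)"
      using vec by simp
    then have "v' *\<^sub>R (I + J) = 0"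
      by (simp add: scaleR_add_right)
    then show ?thesis
      using u \<open>v = - v'\<close> by (auto simp: add_eq_0_iff2)
  qed
qed (auto simp: slice_point_def)

text \<open>
  \<open>U\<close> is meant to be an open subset of the space of paravectors.  A function on \<open>U\<close> is represented
  by a total function on the algebra whose values outside \<open>U\<close> are irrelevant; in particular
  differentiability is taken within \<open>U\<close>, i.e. with respect to the \<open>n + 1\<close> real variables.
\<close>

definition slice_monogenic ::
    "'n::{finite,linorder} clifford set \<Rightarrow> ('n clifford \<Rightarrow> 'n clifford) set" where
  "slice_monogenic U = {f. f differentiable_on U \<and>
    (\<forall>I\<in>unit_sphere. \<forall>u v. slice_point I u v \<in> U \<longrightarrow>
      (1 / 2) *\<^sub>R (vector_derivative (\<lambda>s. f (slice_point I s v)) (at u)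
        + I * vector_derivative (\<lambda>t. f (slice_point I u t)) (at v)) = 0)}"

definition slice_extension ::
    "'n::{finite,linorder} clifford \<Rightarrow> ('n clifford \<Rightarrow> 'n clifford) \<Rightarrow> 'n clifford \<Rightarrow> 'n clifford" where
  "slice_extension I h x = (THE y. \<exists>J u v. J \<in> unit_sphere \<and> x = slice_point J u v \<and>
    y = (1 / 2) *\<^sub>R (h (slice_point I u (- v)) + h (slice_point I u v))
      + (1 / 2) *\<^sub>R (J * I * (h (slice_point I u (- v)) - h (slice_point I u v))))"

lemma slice_extension_slice_point:
  assumes "J \<in> unit_sphere"
  shows "slice_extension I h (slice_point J u v)
    = (1 / 2) *\<^sub>R (h (slice_point I u (- v)) + h (slice_point I u v))
      + (1 / 2) *\<^sub>R (J * I * (h (slice_point I u (- v)) - h (slice_point I u v)))"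
  unfolding slice_extension_def
proof (rule the_equality)
  fix y
  assume "\<exists>J' u' v'. J' \<in> unit_sphere \<and> slice_point J u v = slice_point J' u' v' \<and>
    y = (1 / 2) *\<^sub>R (h (slice_point I u' (- v')) + h (slice_point I u' v'))
      + (1 / 2) *\<^sub>R (J' * I * (h (slice_point I u' (- v')) - h (slice_point I u' v')))"
  then obtain J' u' v' where "J' \<in> unit_sphere" "slice_point J u v = slice_point J' u' v'"
    and y: "y = (1 / 2) *\<^sub>R (h (slice_point I u' (- v')) + h (slice_point I u' v'))
      + (1 / 2) *\<^sub>R (J' * I * (h (slice_point I u' (- v')) - h (slice_point I u' v')))"
    by blast
  then have "u = u'" "v = 0 \<and> v' = 0 \<or> v = v' \<and> J = J' \<or> v = - v' \<and> J = - J'"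
    using assms by (simp_all add: slice_point_eq_iff)
  then consider "u = u'" "v = 0" "v' = 0" | "u = u'" "v = v'" "J = J'" | "u = u'" "v = - v'" "J = - J'"
    by blast
  then show "y = (1 / 2) *\<^sub>R (h (slice_point I u (- v)) + h (slice_point I u v))
      + (1 / 2) *\<^sub>R (J * I * (h (slice_point I u (- v)) - h (slice_point I u v)))"
  proof cases
    case 3
    have "- J' * I * (h (slice_point I u' v') - h (slice_point I u' (- v')))
        = J' * I * (h (slice_point I u' (- v')) - h (slice_point I u' v'))"
      by (simp add: right_diff_distrib)
    then show ?thesis
      by (simp only: y 3 minus_minus add.commute)
  qed (simp_all add: y)
qed (intro exI [of _ J] exI [of _ u] exI [of _ v] conjI refl assms)

definition approach_region ::
    "'n::{finite,linorder} clifford \<Rightarrow> real \<Rightarrow> real \<Rightarrow> 'n clifford set" where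
  "approach_region I \<alpha> v = {slice_point I s t | s t. 0 < s \<and> \<bar>t - v\<bar> < \<alpha> * s}"

definition has_nontangential_limit ::
    "('n::{finite,linorder} clifford \<Rightarrow> 'n clifford) \<Rightarrow> 'n clifford \<Rightarrow> real \<Rightarrow> 'n clifford \<Rightarrow> bool" where
  "has_nontangential_limit f I v l \<longleftrightarrow>
    (\<forall>\<alpha>>0. (f \<longlongrightarrow> l) (at (slice_point I 0 v) within approach_region I \<alpha> v))"

definition boundary_value ::
    "('n::{finite,linorder} clifford \<Rightarrow> 'n clifford) \<Rightarrow> 'n clifford \<Rightarrow> real \<Rightarrow> 'n clifford" where
  "boundary_value f I v = (THE l. has_nontangential_limit f I v l)"

text \<open>
  \<open>boundary_value f I v\<close> is \<open>f(Iv)\<close>.  Finiteness of the boundary integrals (the last condition)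
  does not by itself define a Hardy space: \<open>e\<^sup>x (1 + x)\<^sup>-\<^sup>2\<close> is slice monogenic with boundary values of
  modulus \<open>1 / (1 + v\<^sup>2)\<close>, which lie in every \<open>L\<^sup>p\<close>, but it grows exponentially on the positive real
  axis and is not the Cauchy integral of its boundary values.  The first condition therefore
  requires the restriction of \<open>f\<close> to every half plane to belong to the classical Hardy space \<open>H\<^sup>p\<close>.
\<close>

definition hardy_slice ::
    "real \<Rightarrow> ('n::{finite,linorder} clifford \<Rightarrow> 'n clifford) set" where
  "hardy_slice p = {f \<in> slice_monogenic half_space.
    (\<forall>I\<in>unit_sphere.
      (SUP u\<in>{0<..}. \<integral>\<^sup>+ v. ennreal (norm (f (slice_point I u v)) powr p) \<partial>lebesgue) < \<infinity>) \<and>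
    (\<forall>I\<in>unit_sphere. AE v in lebesgue. \<exists>l. has_nontangential_limit f I v l) \<and>
    (SUP I\<in>unit_sphere. \<integral>\<^sup>+ v. ennreal (norm (boundary_value f I v) powr p) \<partial>lebesgue) < \<infinity>}"

text \<open>
  The constant \<^const>\<open>exp\<close> is not available because the Euclidean norm of the Clifford algebra is
  not submultiplicative.
\<close>

definition clifford_exp :: "'n::{finite,linorder} clifford \<Rightarrow> 'n clifford" where
  "clifford_exp x = (\<Sum>k. x ^ k /\<^sub>R fact k)"

definition half_plane_kernel ::
    "'n::{finite,linorder} clifford \<Rightarrow> 'n clifford \<Rightarrow> real \<Rightarrow> real \<Rightarrow> 'n clifford" where
  "half_plane_kernel I z \<xi> \<eta> =
    (1 / (2 * pi)) *\<^sub>R (LINT w:{..0}|lebesgue. clifford_exp (w *\<^sub>R (z + slice_point I \<xi> (- \<eta>))))"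

text \<open>\<open>half_space_kernel I x \<xi> \<eta>\<close> is the value of the kernel at the pair \<open>(x, \<xi> + I\<eta>)\<close>.\<close>

definition half_space_kernel ::
    "'n::{finite,linorder} clifford \<Rightarrow> 'n clifford \<Rightarrow> real \<Rightarrow> real \<Rightarrow> 'n clifford" where
  "half_space_kernel I x \<xi> \<eta> = slice_extension I (\<lambda>z. half_plane_kernel I z \<xi> \<eta>) x"


lemma slice_point_mult:
  assumes "I \<in> unit_sphere"
  shows "slice_point I a b * slice_point I c d = slice_point I (a * c - b * d) (a * d + b * c)"
  using assms
  by (simp add: slice_point_def of_real_def unit_sphere_square algebra_simps)

lemma clifford_exp_slice_point:
  assumes "I \<in> unit_sphere"
  shows "clifford_exp (slice_point I a b) = exp a *\<^sub>R slice_point I (cos b) (sin b)"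
proof -
  define \<phi> where "\<phi> z = slice_point I (Re z) (Im z)" for z
  have "linear \<phi>"
    by (rule linearI) (simp_all add: \<phi>_def slice_point_def of_real_def algebra_simps)
  then have bl: "bounded_linear \<phi>"
    by (simp add: linear_conv_bounded_linear)
  have pow: "\<phi> (z ^ k) = \<phi> z ^ k" for z k
  proof (induction k)
    case 0
    show ?case by (simp add: \<phi>_def slice_point_def)
  next
    case (Suc k)
    have "\<phi> (z ^ Suc k) = \<phi> z * \<phi> (z ^ k)"
      using assms by (simp add: \<phi>_def slice_point_mult)
    then show ?case
      by (simp add: Suc)
  qed
  have "(\<lambda>k. \<phi> (Complex a b ^ k /\<^sub>R fact k)) sums \<phi> (exp (Complex a b))"
    by (rule bounded_linear.sums [OF bl exp_converges])
  then have "(\<lambda>k. slice_point I a b ^ k /\<^sub>R fact k) sums \<phi> (exp (Complex a b))"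
    by (simp only: linear_scale [OF \<open>linear \<phi>\<close>] pow) (simp add: \<phi>_def)
  then have "clifford_exp (slice_point I a b) = \<phi> (exp (Complex a b))"
    by (simp add: clifford_exp_def sums_iff)
  also have "\<dots> = exp a *\<^sub>R slice_point I (cos b) (sin b)"
    by (simp add: \<phi>_def Re_exp Im_exp slice_point_def of_real_def algebra_simps)
  finally show ?thesis .
qed

lemma scaleR_slice_point: "w *\<^sub>R slice_point I a b = slice_point I (w * a) (w * b)"
  by (simp add: slice_point_def of_real_def algebra_simps)

lemma slice_point_add: "slice_point I a b + slice_point I c d = slice_point I (a + c) (b + d)"
  by (simp add: slice_point_def algebra_simps)

lemma set_integrable_clifford_exp:
  fixes I :: "'n::{finite,linorder} clifford"
  assumes "I \<in> unit_sphere" "0 < a"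
  shows "set_integrable lebesgue {..0} (\<lambda>w. clifford_exp (w *\<^sub>R slice_point I a b))"
proof -
  have ex: "clifford_exp (w *\<^sub>R slice_point I a b)
      = exp (a * w) *\<^sub>R (cos (w * b) *\<^sub>R 1 + sin (w * b) *\<^sub>R I)" for w
    unfolding scaleR_slice_point clifford_exp_slice_point [OF assms(1)]
    by (simp add: slice_point_def of_real_def scaleR_add_right mult.commute)
  have "(\<lambda>x. exp (- a * x)) absolutely_integrable_on {0..}"
    using integrable_on_exp_minus_to_infinity [OF \<open>0 < a\<close>]
    by (intro nonnegative_absolutely_integrable_1) auto
  then have "integrable lborel (\<lambda>x. indicator {0..} x *\<^sub>R exp (- a * x))"
    by (simp add: set_integrable_def integrable_completion)
  then have "integrable lborel (\<lambda>x. indicator {0..} (0 + (-1) * x) *\<^sub>R exp (- a * (0 + (-1) * x)))"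
    by (intro lborel_integrable_real_affine) auto
  moreover have "(\<lambda>x. indicator {0..} (0 + (-1) * x) *\<^sub>R exp (- a * (0 + (-1) * x)))
      = (\<lambda>x. indicator {..0} x *\<^sub>R exp (a * x) :: real)"
    by (auto simp: indicator_def)
  ultimately have "integrable lborel (\<lambda>x. indicator {..0} x *\<^sub>R exp (a * x))"
    by (simp only:)
  then have dom: "set_integrable lborel {..0} (\<lambda>x. (1 + norm I) * exp (a * x))"
    unfolding set_integrable_def by (simp add: mult.left_commute)
  have "set_integrable lborel {..0} (\<lambda>w. clifford_exp (w *\<^sub>R slice_point I a b))"
  proof (rule set_integrable_bound [OF dom])
    show "set_borel_measurable lborel {..0} (\<lambda>w. clifford_exp (w *\<^sub>R slice_point I a b))"
      unfolding set_borel_measurable_def ex by measurable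
    show "AE w in lborel. w \<in> {..0} \<longrightarrow> norm (clifford_exp (w *\<^sub>R slice_point I a b))
        \<le> norm ((1 + norm I) * exp (a * w))"
    proof (intro AE_I2 impI)
      fix w :: real
      have "norm (1 :: 'n clifford) = 1"
        by (simp add: norm_clifford_def one_clifford_def if_distrib [of "\<lambda>r. r\<^sup>2"] cong: if_cong)
      then have "norm (cos (w * b) *\<^sub>R (1 :: 'n clifford)) \<le> 1"
        by simp
      moreover have "norm (sin (w * b) *\<^sub>R I) \<le> norm I"
        by (simp add: mult_left_le_one_le)
      ultimately have "norm (cos (w * b) *\<^sub>R 1 + sin (w * b) *\<^sub>R I) \<le> 1 + norm I"
        by (rule order_trans [OF norm_triangle_ineq add_mono])
      then have "exp (a * w) * norm (cos (w * b) *\<^sub>R 1 + sin (w * b) *\<^sub>R I)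
          \<le> exp (a * w) * (1 + norm I)"
        by (intro mult_left_mono) auto
      also have "\<dots> \<le> norm ((1 + norm I) * exp (a * w))"
        unfolding real_norm_def by (subst mult.commute) (rule abs_ge_self)
      finally show "norm (clifford_exp (w *\<^sub>R slice_point I a b)) \<le> norm ((1 + norm I) * exp (a * w))"
        unfolding ex norm_scaleR by simp
    qed
  qed
  then show ?thesis
    unfolding set_integrable_def by (subst integrable_completion) auto
qed

lemma half_space_kernel_explicit:
  assumes "I \<in> unit_sphere" "J \<in> unit_sphere" "0 < u + \<xi>"
  shows "half_space_kernel I (slice_point J u v) \<xi> \<eta> = (1 / (2 * pi)) *\<^sub>R
    (LINT w:{..0}|lebesgue. clifford_exp (w *\<^sub>R slice_point J u v) * clifford_exp (w *\<^sub>R slice_point I \<xi> (- \<eta>)))"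
proof -
  define E where "E t w = clifford_exp (w *\<^sub>R slice_point I (u + \<xi>) (t - \<eta>))" for t w
  have E: "set_integrable lebesgue {..0} (E t)" for t
    unfolding E_def by (rule set_integrable_clifford_exp [OF assms(1,3)])
  have bl: "bounded_linear (\<lambda>y. J * I * y)"
    unfolding linear_conv_bounded_linear [symmetric] by (rule linearI) (simp_all add: distrib_left)
  have ptw: "(1 / 2) *\<^sub>R (E (- v) w + E v w) + (1 / 2) *\<^sub>R (J * I * (E (- v) w - E v w))
      = clifford_exp (w *\<^sub>R slice_point J u v) * clifford_exp (w *\<^sub>R slice_point I \<xi> (- \<eta>))" for w
  proof -
    define X where "X = clifford_exp (w *\<^sub>R slice_point I \<xi> (- \<eta>))"
    have Et: "E t w = exp (w * u) *\<^sub>R (slice_point I (cos (w * t)) (sin (w * t)) * X)" for t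
      unfolding E_def X_def scaleR_slice_point clifford_exp_slice_point [OF assms(1)]
      by (simp add: slice_point_mult [OF assms(1)] exp_add scaleR_slice_point
          cos_diff sin_diff algebra_simps)
    have "slice_point I (cos (w * - v)) (sin (w * - v)) + slice_point I (cos (w * v)) (sin (w * v))
        = (2 * cos (w * v)) *\<^sub>R 1"
      by (simp add: slice_point_def of_real_def flip: scaleR_left_distrib)
    then have 1: "E (- v) w + E v w = exp (w * u) *\<^sub>R ((2 * cos (w * v)) *\<^sub>R X)"
      unfolding Et by (metis distrib_right mult_1_left mult_scaleR_left scaleR_add_right)
    have "slice_point I (cos (w * - v)) (sin (w * - v)) - slice_point I (cos (w * v)) (sin (w * v))
        = (- 2 * sin (w * v)) *\<^sub>R I"
      by (rule clifford_eqI) (simp add: slice_point_def)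
    then have 2: "E (- v) w - E v w = exp (w * u) *\<^sub>R ((- 2 * sin (w * v)) *\<^sub>R (I * X))"
      unfolding Et by (metis left_diff_distrib mult_scaleR_left scaleR_diff_right)
    have "J * I * (I * X) = J * ((I * I) * X)"
      by (simp only: mult.assoc)
    then have 3: "J * I * (I * X) = - (J * X)"
      by (simp only: unit_sphere_square [OF assms(1)]) simp
    have "J * I * (E (- v) w - E v w) = exp (w * u) *\<^sub>R ((2 * sin (w * v)) *\<^sub>R (J * X))"
      unfolding 2 mult_scaleR_right 3 by simp
    moreover have "clifford_exp (w *\<^sub>R slice_point J u v)
        = exp (w * u) *\<^sub>R (cos (w * v) *\<^sub>R 1 + sin (w * v) *\<^sub>R J)"
      unfolding scaleR_slice_point clifford_exp_slice_point [OF assms(2)]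
      by (simp add: slice_point_def of_real_def scaleR_add_right)
    ultimately show ?thesis
      unfolding 1 X_def [symmetric] by (simp add: distrib_right scaleR_add_right)
  qed
  have k: "half_plane_kernel I (slice_point I u t) \<xi> \<eta>
      = (1 / (2 * pi)) *\<^sub>R (LINT w:{..0}|lebesgue. E t w)" for t
    by (simp add: half_plane_kernel_def E_def slice_point_add)
  have "half_space_kernel I (slice_point J u v) \<xi> \<eta> = (1 / (2 * pi)) *\<^sub>R
      ((1 / 2) *\<^sub>R ((LINT w:{..0}|lebesgue. E (- v) w) + (LINT w:{..0}|lebesgue. E v w))
      + (1 / 2) *\<^sub>R (J * I * ((LINT w:{..0}|lebesgue. E (- v) w) - (LINT w:{..0}|lebesgue. E v w))))"
    unfolding half_space_kernel_def slice_extension_slice_point [OF assms(2)] k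
    by (simp add: algebra_simps)
  also have "J * I * ((LINT w:{..0}|lebesgue. E (- v) w) - (LINT w:{..0}|lebesgue. E v w))
      = (LINT w:{..0}|lebesgue. J * I * (E (- v) w - E v w))"
  proof -
    have "J * I * (LINT w:{..0}|lebesgue. E (- v) w - E v w)
        = (LINT w|lebesgue. J * I * (indicator {..0} w *\<^sub>R (E (- v) w - E v w)))"
      unfolding set_lebesgue_integral_def
      using set_integral_diff(1) [OF E E]
      by (intro integral_bounded_linear [OF bl, symmetric]) (simp add: set_integrable_def)
    then show ?thesis
      unfolding set_integral_diff(2) [OF E E] by (simp add: set_lebesgue_integral_def)
  qed
  also have "(1 / 2) *\<^sub>R ((LINT w:{..0}|lebesgue. E (- v) w) + (LINT w:{..0}|lebesgue. E v w))
      + (1 / 2) *\<^sub>R (LINT w:{..0}|lebesgue. J * I * (E (- v) w - E v w))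
      = (LINT w:{..0}|lebesgue. (1 / 2) *\<^sub>R (E (- v) w + E v w) + (1 / 2) *\<^sub>R (J * I * (E (- v) w - E v w)))"
  proof -
    have i: "set_integrable lebesgue {..0} (\<lambda>w. J * I * (E (- v) w - E v w))"
      using integrable_bounded_linear [OF bl set_integral_diff(1) [OF E E, unfolded set_integrable_def]]
      by (simp add: set_integrable_def)
    show ?thesis
      by (simp add: set_integral_add(1) set_integral_add(2) E i)
  qed
  finally show ?thesis
    by (simp only: ptw)
qed

end

theory Submission
  imports Defs "HOL-Complex_Analysis.Complex_Analysis"
begin

text \<open>
  For \<open>I\<close> in the sphere and every real-linear \<open>L\<close> with \<open>L (I a) = \<i> L a\<close>, the function
  \<open>L \<circ> f\<close> on the plane of \<open>I\<close> lies in the classical Hardy space \<open>H\<^sup>p\<close> of the right half plane, and these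
  functionals separate points; so the Cauchy formula on the plane of \<open>I\<close> is a statement about complex
  functions \<open>g\<close>.  Multiplication by \<open>k / (k + z)\<close>, with \<open>k \<rightarrow> \<infinity>\<close> in the end, reduces it to
  \<open>p = 1\<close>.  There the difficulty is to
  recover \<open>g\<close> from its almost everywhere boundary limit \<open>g\<^sup>*\<close>, since a bounded sequence in \<open>L\<^sup>1\<close> may
  concentrate on a null set.  It is overcome by the subharmonicity of \<open>\<bar>g\<bar>\<^sup>1\<^sup>/\<^sup>2\<close>: on vertical lines this
  is bounded in \<open>L\<^sup>2\<close>, so its Poisson majorant passes to the limit and yields \<open>\<bar>g\<bar> \<le> P[\<bar>g\<^sup>*\<bar>]\<close>.  Hence the
  \<open>L\<^sup>1\<close> norm on each vertical line is at most that of \<open>g\<^sup>*\<close>, and Scheffe's lemma gives convergence in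
  \<open>L\<^sup>1\<close>, under which the Cauchy formula on vertical lines survives.  Other planes are reached by the
  representation formula, which has the same shape as the extension defining the kernel.
\<close>

section \<open>The Poisson and Cauchy formulas on the half plane\<close>

definition poisson :: "complex \<Rightarrow> real \<Rightarrow> real" where
  "poisson z t = Re z / (pi * (cmod (z - Complex 0 t))\<^sup>2)"

text \<open>\<open>arctan\<close> is a primitive with limits \<open>- (pi / 2)\<close> and
  \<open>pi / 2\<close>; as the integrand is nonnegative, the fundamental theorem yields
  integrability together with the value. The integrand later serves as a majorant for functions with
  quadratic decay.\<close>

lemma has_bochner_integral_inverse_square:
  "has_bochner_integral lborel (\<lambda>t::real. 1 / (1 + t\<^sup>2)) pi"
proof -
  have top: "((arctan \<circ> real_of_ereal) \<longlongrightarrow> pi / 2) (at_left \<infinity>)"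
    using tendsto_arctan_at_top by (simp add: ereal_tendsto_simps)
  have bot: "((arctan \<circ> real_of_ereal) \<longlongrightarrow> - (pi / 2)) (at_right (- \<infinity>))"
    using tendsto_arctan_at_bot by (simp add: ereal_tendsto_simps)
  have "1 + t\<^sup>2 \<noteq> 0" for t :: real
    by (metis add_cancel_left_right power2_less_0 sum_power2_eq_zero_iff one_neq_zero power_one)
  then have c: "isCont (\<lambda>t::real. 1 / (1 + t\<^sup>2)) x" for x
    by (intro continuous_intros) auto
  have d: "DERIV arctan x :> 1 / (1 + x\<^sup>2)" for x
    using DERIV_arctan[of x] by (simp add: inverse_eq_divide)
  note FTC = interval_integral_FTC_nonneg[of "-\<infinity>" "\<infinity>", OF _ d c _ bot top]
  have 1: "set_integrable lborel (einterval (-\<infinity>) \<infinity>) (\<lambda>t::real. 1 / (1 + t\<^sup>2))"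
    by (rule FTC(1)) auto
  have 2: "(LBINT t=-\<infinity>..\<infinity>. 1 / (1 + t\<^sup>2)) = pi / 2 - - (pi/2)"
    by (rule FTC(2)) auto
  show ?thesis
    using 1 2 by (simp add: has_bochner_integral_iff set_integrable_def
        interval_lebesgue_integral_def set_lebesgue_integral_def)
qed

lemma poisson_nonneg: "0 \<le> Re z \<Longrightarrow> 0 \<le> poisson z t"
  by (simp add: poisson_def)

lemma norm_diff_Complex_0:
  "(cmod (z - Complex 0 t))\<^sup>2 = (Re z)\<^sup>2 + (t - Im z)\<^sup>2"
  by (simp add: cmod_power2 power2_commute)

text \<open>The affine substitution \<open>s = (t - Im z) / Re z\<close> reduces the kernel to
  \<open>1 / (1 + s\<^sup>2)\<close>. Mass \<open>1\<close> makes every Poisson integral an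
  average.\<close>

lemma has_bochner_integral_poisson:
  assumes "0 < Re z"
  shows "has_bochner_integral lborel (poisson z) 1"
proof -
  let ?f = "\<lambda>t::real. 1 / (1 + t\<^sup>2)"
  have "has_bochner_integral lborel (\<lambda>t. ?f (- Im z / Re z + (1 / Re z) * t)) (pi * Re z)"
  proof -
    have "integrable lborel (\<lambda>t. ?f (- Im z / Re z + (1 / Re z) * t))"
      by (rule lborel_integrable_real_affine)
        (use assms has_bochner_integral_inverse_square in \<open>auto simp: has_bochner_integral_iff\<close>)
    moreover have "(LINT t|lborel. ?f (- Im z / Re z + (1 / Re z) * t)) = pi * Re z"
      using assms has_bochner_integral_inverse_square
        lborel_integral_real_affine[of "1 / Re z" ?f "- Im z / Re z"]
      by (simp add: has_bochner_integral_iff field_simps)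
    ultimately show ?thesis
      by (simp add: has_bochner_integral_iff)
  qed
  then have "has_bochner_integral lborel
      (\<lambda>t. (1 / (pi * Re z)) * ?f (- Im z / Re z + (1 / Re z) * t)) ((1 / (pi * Re z)) * (pi * Re z))"
    by (rule has_bochner_integral_mult_right)
  moreover have "(1 / (pi * Re z)) * ?f (- Im z / Re z + (1 / Re z) * t) = poisson z t" for t
  proof -
    have e: "- Im z / Re z + (1 / Re z) * t = (t - Im z) / Re z"
      using assms by (simp add: field_simps)
    have n: "0 < (Re z)\<^sup>2 + (t - Im z)\<^sup>2"
      using assms by (simp add: add_pos_nonneg)
    have "1 + ((t - Im z) / Re z)\<^sup>2 = ((Re z)\<^sup>2 + (t - Im z)\<^sup>2) / (Re z)\<^sup>2"
      using assms by (simp add: field_simps)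
    then show ?thesis
      unfolding poisson_def norm_diff_Complex_0 e using assms n
      by (simp add: power2_eq_square)
  qed
  ultimately show ?thesis
    using assms by simp
qed

text \<open>The maximum is at \<open>t = Im z\<close>. Boundedness in \<open>t\<close> makes
  products with integrable functions integrable.\<close>

lemma poisson_le:
  assumes "0 < Re z"
  shows "poisson z t \<le> 1 / (pi * Re z)"
proof -
  have "(Re z)\<^sup>2 \<le> (Re z)\<^sup>2 + (t - Im z)\<^sup>2"
    by simp
  then have "poisson z t \<le> Re z / (pi * (Re z)\<^sup>2)"
    unfolding poisson_def norm_diff_Complex_0 using assms
    by (intro divide_left_mono mult_left_mono mult_pos_pos) (auto simp: add_pos_nonneg)
  then show ?thesis
    using assms by (simp add: power2_eq_square)
qed

lemma borel_measurable_Complex [measurable]: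
  fixes f g :: "'a \<Rightarrow> real"
  shows "f \<in> borel_measurable M \<Longrightarrow> g \<in> borel_measurable M \<Longrightarrow>
    (\<lambda>x. Complex (f x) (g x)) \<in> borel_measurable M"
  unfolding Complex_eq
  by (intro borel_measurable_add borel_measurable_times borel_measurable_const measurable_compose[OF _ borel_measurable_of_real])

lemma poisson_measurable [measurable]: "poisson z \<in> borel_measurable borel"
  unfolding poisson_def by measurable

text \<open>The half disc of radius \<open>r\<close> in the closed half plane is a closed contour along which the
  integral vanishes, and its circular part contributes at most \<open>\<pi> C / r\<close>.\<close>

lemma integral_imaginary_axis_eq_0:
  assumes "0 < d" and hol: "\<phi> holomorphic_on {z. - d < Re z}"
    and bd: "\<And>z. 0 \<le> Re z \<Longrightarrow> R \<le> cmod z \<Longrightarrow> cmod (\<phi> z) \<le> C / (cmod z)\<^sup>2"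
  shows "has_bochner_integral lborel (\<lambda>t. \<phi> (Complex 0 t)) 0"
proof -
  define h where "h t = \<phi> (Complex 0 t)" for t
  have conth: "continuous_on UNIV h"
    unfolding h_def
    by (rule continuous_on_compose2[OF holomorphic_on_imp_continuous_on[OF hol]])
      (use \<open>0 < d\<close> in \<open>auto intro!: continuous_intros\<close>)
  then have [measurable]: "h \<in> borel_measurable borel"
    by (rule borel_measurable_continuous_onI)
  define r0 where "r0 = max R 1"
  have "compact (h ` {-r0..r0})"
    using conth by (intro compact_continuous_image continuous_on_subset[OF conth]) auto
  then obtain B where B0: "\<And>t. t \<in> {-r0..r0} \<Longrightarrow> norm (h t) \<le> B"
    by (meson bounded_iff compact_imp_bounded imageI)
  have B: "norm (h t) \<le> max B 0" if "\<bar>t\<bar> \<le> r0" for t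
    using B0[of t] that by (intro max.coboundedI1) (simp add: abs_le_iff)
  have "0 \<le> C"
  proof -
    have "0 \<le> cmod (\<phi> (Complex r0 0))" by simp
    also have "\<dots> \<le> C / (cmod (Complex r0 0))\<^sup>2"
      by (rule bd) (auto simp: r0_def cmod_def)
    finally show ?thesis
      by (auto simp: cmod_def r0_def zero_le_divide_iff split: if_splits)
  qed
  \<comment> \<open>The first summand covers \<open>\<bar>t\<bar> \<le> r0\<close>, where
    \<open>h\<close> is bounded by compactness. The second covers the rest, where
    \<open>1 + t\<^sup>2 \<le> 2 * t\<^sup>2\<close> because \<open>r0\<close> is at least
    \<open>1\<close>.\<close>
  define K where "K = max B 0 * (1 + r0\<^sup>2) + 2 * C"
  have hK: "norm (h t) \<le> K * (1 / (1 + t\<^sup>2))" for t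
  proof (cases "\<bar>t\<bar> \<le> r0")
    case True
    then have "t\<^sup>2 \<le> r0\<^sup>2"
      using abs_le_square_iff[of t r0] by (simp add: r0_def)
    then have "norm (h t) * (1 + t\<^sup>2) \<le> max B 0 * (1 + r0\<^sup>2)"
      using B[OF True] by (intro mult_mono) auto
    then show ?thesis
      using \<open>0 \<le> C\<close> by (auto simp: K_def field_simps add_pos_nonneg)
  next
    case False
    then have t: "1 \<le> t\<^sup>2"
      using abs_le_square_iff[of 1 t] by (auto simp: r0_def)
    then have t0: "t \<noteq> 0"
      by auto
    have "norm (h t) \<le> C / (cmod (Complex 0 t))\<^sup>2"
      unfolding h_def by (rule bd) (use False in \<open>auto simp: r0_def cmod_def\<close>)
    then have "norm (h t) * t\<^sup>2 \<le> C"
      using t0 by (simp add: cmod_power2 pos_le_divide_eq)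
    moreover have "norm (h t) * (1 + t\<^sup>2) \<le> norm (h t) * (2 * t\<^sup>2)"
      using t by (intro mult_left_mono) auto
    moreover have "0 \<le> max B 0 * (1 + r0\<^sup>2)"
      by auto
    ultimately have "norm (h t) * (1 + t\<^sup>2) \<le> K"
      unfolding K_def by linarith
    then show ?thesis
      by (auto simp: field_simps add_pos_nonneg)
  qed
  have dom: "integrable lborel (\<lambda>t. K * (1 / (1 + t\<^sup>2)))"
    by (intro integrable_mult_right has_bochner_integral_inverse_square[THEN integrable.intros])
  have int: "integrable lborel h"
    by (rule Bochner_Integration.integrable_bound[OF dom _ AE_I2])
      (simp, unfold real_norm_def, rule order_trans[OF hK abs_ge_self])
  have lim: "(\<lambda>k::nat. LINT t|lborel. indicator {- real k..real k} t *\<^sub>R h t) \<longlonglongrightarrow> (LINT t|lborel. h t)"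
  proof (rule integral_dominated_convergence[OF _ _ dom])
    show "AE t in lborel. (\<lambda>k. indicator {- real k..real k} t *\<^sub>R h t) \<longlonglongrightarrow> h t"
    proof (intro AE_I2 tendsto_eventually)
      fix t
      show "\<forall>\<^sub>F k in sequentially. indicator {- real k..real k} t *\<^sub>R h t = h t"
        using eventually_ge_at_top[of "nat \<lceil>\<bar>t\<bar>\<rceil>"]
        by eventually_elim (auto simp: indicator_def split: if_splits; linarith)
    qed
    show "AE t in lborel. norm (indicator {- real k..real k} t *\<^sub>R h t) \<le> K * (1 / (1 + t\<^sup>2))" for k
      using hK by (auto simp: indicator_def intro: order_trans[OF norm_ge_zero])
  qed (auto)
  have bound: "norm (LINT t|lborel. indicator {- real k..real k} t *\<^sub>R h t) \<le> C * pi / real k"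
    if k: "R < real k" "0 < k" for k
  proof -
    let ?k = "real k"
    \<comment> \<open>The segment runs upwards and the arc returns clockwise through the right half
      plane, so the two close up.\<close>
    define l a where "l = linepath (Complex 0 (-?k)) (Complex 0 ?k)"
      and "a = part_circlepath 0 ?k (pi/2) (-(pi/2))"
    have e: "exp (\<i> * (complex_of_real pi / 2)) = \<i>" "exp (- (\<i> * complex_of_real pi / 2)) = - \<i>"
      using cis_conv_exp[of "pi / 2"] cis_conv_exp[of "- (pi / 2)"] by simp_all
    have ends: "pathstart l = Complex 0 (-?k)" "pathfinish l = Complex 0 ?k"
      "pathstart a = Complex 0 ?k" "pathfinish a = Complex 0 (-?k)"
      unfolding l_def a_def using e by (auto simp: Complex_eq mult_ac)
    have pa: "0 \<le> Re z \<and> cmod z = ?k" if "z \<in> path_image a" for z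
    proof -
      from that obtain x where x: "x \<in> closed_segment (pi/2) (-(pi/2))" "z = of_real ?k * cis x"
        unfolding a_def path_image_part_circlepath' by auto
      then have "0 \<le> cos x"
        by (intro cos_ge_zero) (auto simp: closed_segment_eq_real_ivl split: if_splits)
      then show ?thesis
        using x(2) by (simp add: norm_mult)
    qed
    have pl: "path_image l \<subseteq> {z. - d < Re z}"
      using \<open>0 < d\<close> by (auto simp: l_def closed_segment_same_Re)
    have pa': "path_image a \<subseteq> {z. - d < Re z}"
      using pa \<open>0 < d\<close> by fastforce
    have vl: "valid_path l" "valid_path a"
      by (auto simp: l_def a_def)
    have "(\<phi> has_contour_integral 0) (l +++ a)"
      \<comment> \<open>Holomorphy slightly beyond the axis places the whole contour in an open
        convex domain.\<close>
      by (rule Cauchy_theorem_convex_simple[OF hol convex_halfspace_Re_gt])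
        (use vl ends pl pa' in \<open>auto simp: path_image_join\<close>)
    moreover have il: "\<phi> contour_integrable_on l" and ia: "\<phi> contour_integrable_on a"
      unfolding l_def a_def
      by (intro contour_integrable_continuous_linepath contour_integrable_continuous_part_circlepath
          continuous_on_subset[OF holomorphic_on_imp_continuous_on[OF hol]];
          use pl pa' in \<open>auto simp: l_def a_def\<close>)+
    ultimately have "contour_integral l \<phi> + contour_integral a \<phi> = 0"
      using vl ends by (metis contour_integral_join contour_integral_unique)
    moreover have "norm (contour_integral a \<phi>) \<le> (C / ?k\<^sup>2) * ?k * \<bar>-(pi/2) - pi/2\<bar>"
      unfolding a_def
    proof (rule contour_integral_bound_part_circlepath)
      show "\<phi> contour_integrable_on part_circlepath 0 ?k (pi/2) (-(pi/2))"
        using ia by (simp add: a_def)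
      show "cmod (\<phi> x) \<le> C / ?k\<^sup>2" if "x \<in> path_image (part_circlepath 0 ?k (pi/2) (-(pi/2)))" for x
        using bd[of x] pa[of x] that k by (auto simp: a_def)
    qed (use \<open>0 \<le> C\<close> in auto)
    moreover have "contour_integral l \<phi> = \<i> * integral {-?k..?k} h"
      unfolding l_def h_def using k by (subst contour_integral_linepath_same_Re[where c=0]) auto
    moreover have "(LINT t|lborel. indicator {- ?k..?k} t *\<^sub>R h t) = integral {-?k..?k} h"
      using set_borel_integral_eq_integral(2)[of "{-?k..?k}" h] integrable_mult_indicator[OF _ int]
      by (simp add: set_integrable_def set_lebesgue_integral_def)
    ultimately have "norm (LINT t|lborel. indicator {- ?k..?k} t *\<^sub>R h t) \<le> (C / ?k\<^sup>2) * ?k * \<bar>-(pi/2) - pi/2\<bar>"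
      by (metis add_eq_0_iff norm_minus_cancel norm_mult norm_ii mult_1)
    then show ?thesis
      using k by (simp add: power2_eq_square)
  qed
  have "(\<lambda>k::nat. C * pi / real k) \<longlonglongrightarrow> 0"
    by (rule lim_const_over_n)
  moreover have "\<forall>\<^sub>F k in sequentially. norm (LINT t|lborel. indicator {- real k..real k} t *\<^sub>R h t)
      \<le> C * pi / real k"
    using eventually_gt_at_top[of "nat \<lceil>R\<rceil>"]
    by eventually_elim (rule bound; linarith)
  ultimately have "(\<lambda>k::nat. LINT t|lborel. indicator {- real k..real k} t *\<^sub>R h t) \<longlonglongrightarrow> 0"
    by (rule Lim_null_comparison[rotated])
  with lim have "(LINT t|lborel. h t) = 0"
    by (rule LIMSEQ_unique)
  with int show ?thesis
    by (simp add: has_bochner_integral_iff h_def[abs_def])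
qed

section \<open>Reproducing formulas for functions holomorphic across the axis\<close>

text \<open>The difference quotient of \<open>H\<close> at \<open>z\<close>, divided by
  \<open>cnj z + w\<close>, is holomorphic in \<open>w\<close> and decays quadratically, so its
  integral over the axis vanishes. For \<open>w\<close> on the axis
  \<open>(w - z) * (cnj z + w)\<close> is minus the square of \<open>cmod (z - w)\<close>, so this
  integrand is, up to a constant, the Poisson kernel times \<open>H w - H z\<close>. Mass
  \<open>1\<close> of the kernel restores \<open>H z\<close>.\<close>

lemma poisson_formula:
  assumes "0 < d" and hol: "H holomorphic_on {z. - d < Re z}"
    and bd: "\<And>z. 0 \<le> Re z \<Longrightarrow> cmod (H z) \<le> B" and z: "0 < Re z"
  shows "has_bochner_integral lborel (\<lambda>t. poisson z t *\<^sub>R H (Complex 0 t)) (H z)"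
proof -
  define \<phi> where "\<phi> w = (if w = z then deriv H z else (H w - H z) / (w - z)) / (cnj z + w)" for w
  have "has_bochner_integral lborel (\<lambda>t. \<phi> (Complex 0 t)) 0"
  proof (rule integral_imaginary_axis_eq_0)
    \<comment> \<open>The denominator vanishes at \<open>- cnj z\<close>, whose real part is
      \<open>- Re z\<close>; the domain has to stop before it.\<close>
    show "0 < min d (Re z)"
      using assms by simp
    have "cnj z + w \<noteq> 0" if "- min d (Re z) < Re w" for w
      using that z by (auto simp: complex_eq_iff)
    then show "\<phi> holomorphic_on {w. - min d (Re z) < Re w}"
      unfolding \<phi>_def
      by (intro holomorphic_on_divide pole_lemma_open open_halfspace_Re_gt
          holomorphic_on_subset[OF hol] holomorphic_intros) auto
    \<comment> \<open>Beyond the radius \<open>2 * cmod z + 1\<close> both factors of the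
      denominator have modulus at least \<open>cmod w / 2\<close>, and the numerator is at most
      \<open>2 * B\<close>; hence the \<open>8\<close>.\<close>
    show "cmod (\<phi> w) \<le> (8 * B) / (cmod w)\<^sup>2" if w: "0 \<le> Re w" "2 * cmod z + 1 \<le> cmod w" for w
    proof -
      have wz: "w \<noteq> z"
      proof
        assume "w = z"
        then show False
          using w(2) norm_ge_zero[of z] by (simp only:)
      qed
      have 1: "cmod w / 2 \<le> cmod (w - z)"
        using norm_triangle_ineq2[of w z] w(2) by linarith
      have 2: "cmod w / 2 \<le> cmod (cnj z + w)"
        using norm_triangle_ineq2[of w "- cnj z"] w(2) by (simp add: add.commute)
      have w0: "0 < cmod w"
        using w(2) norm_ge_zero[of z] by linarith
      have "cmod (H w - H z) \<le> 2 * B"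
        using bd[of w] bd[of z] w z norm_triangle_ineq4[of "H w" "H z"] by simp
      moreover have "cmod w / 2 * (cmod w / 2) \<le> cmod (w - z) * cmod (cnj z + w)"
        by (intro mult_mono 1 2) auto
      moreover have "0 \<le> B"
        using bd[of z] z norm_ge_zero[of "H z"] by linarith
      ultimately have "cmod (H w - H z) / (cmod (w - z) * cmod (cnj z + w)) \<le> 2 * B / (cmod w / 2 * (cmod w / 2))"
        using w0 by (intro frac_le mult_pos_pos) auto
      then have "cmod (\<phi> w) \<le> 2 * B / (cmod w / 2 * (cmod w / 2))"
        unfolding \<phi>_def using wz by (simp add: norm_divide norm_mult divide_divide_eq_left)
      then show ?thesis
        using w0 by (simp add: power2_eq_square)
    qed
  qed
  then have "has_bochner_integral lborel (\<lambda>t. - of_real (Re z / pi) * \<phi> (Complex 0 t)) (- of_real (Re z / pi) * 0)"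
    by (rule has_bochner_integral_mult_right)
  moreover have "- of_real (Re z / pi) * \<phi> (Complex 0 t) = poisson z t *\<^sub>R (H (Complex 0 t) - H z)" for t
  proof -
    have "Complex 0 t \<noteq> z"
      using z by auto
    moreover have "(Complex 0 t - z) * (cnj z + Complex 0 t) = - of_real ((cmod (z - Complex 0 t))\<^sup>2)"
    proof -
      have "(Complex 0 t - z) * (cnj z + Complex 0 t) = - ((z - Complex 0 t) * cnj (z - Complex 0 t))"
        by (simp add: complex_eq_iff algebra_simps)
      then show ?thesis
        by (simp only: complex_norm_square)
    qed
    ultimately show ?thesis
      unfolding \<phi>_def poisson_def by (simp add: scaleR_conv_of_real divide_divide_eq_left)
  qed
  ultimately have "has_bochner_integral lborel (\<lambda>t. poisson z t *\<^sub>R (H (Complex 0 t) - H z)) 0"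
    by simp
  moreover have "has_bochner_integral lborel (\<lambda>t. poisson z t *\<^sub>R H z) (1 *\<^sub>R H z)"
    by (intro has_bochner_integral_scaleR_left has_bochner_integral_poisson z)
  ultimately have "has_bochner_integral lborel
      (\<lambda>t. poisson z t *\<^sub>R (H (Complex 0 t) - H z) + poisson z t *\<^sub>R H z) (0 + 1 *\<^sub>R H z)"
    by (rule has_bochner_integral_add)
  then show ?thesis
    by (simp flip: scaleR_add_right)
qed

text \<open>At a boundary point \<open>w\<close> one has \<open>cnj w = - w\<close>, so the Cauchy kernel at \<open>z\<close> differs from the
  Poisson kernel by \<open>1 / (cnj z + w)\<close>, which is holomorphic in \<open>w\<close>.\<close>

lemma cauchy_formula:
  assumes "0 < d" and hol: "H holomorphic_on {z. - d < Re z}"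
    and bd: "\<And>z. 0 \<le> Re z \<Longrightarrow> cmod (H z) * (1 + cmod z) \<le> B" and z: "0 < Re z"
  shows "has_bochner_integral lborel (\<lambda>t. H (Complex 0 t) / (2 * pi * (z - Complex 0 t))) (H z)"
proof -
  define \<phi> where "\<phi> w = H w / (cnj z + w)" for w
  have bd': "cmod (H w) \<le> B" if "0 \<le> Re w" for w
    using bd[OF that] by (rule order_trans[rotated]) (simp add: distrib_left)
  have "has_bochner_integral lborel (\<lambda>t. \<phi> (Complex 0 t)) 0"
  proof (rule integral_imaginary_axis_eq_0)
    show "0 < min d (Re z)"
      using assms by simp
    have "cnj z + w \<noteq> 0" if "- min d (Re z) < Re w" for w
      using that z by (auto simp: complex_eq_iff)
    then show "\<phi> holomorphic_on {w. - min d (Re z) < Re w}"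
      unfolding \<phi>_def
      by (intro holomorphic_on_divide holomorphic_on_subset[OF hol] holomorphic_intros) auto
    show "cmod (\<phi> w) \<le> (2 * B) / (cmod w)\<^sup>2" if w: "0 \<le> Re w" "2 * cmod z + 1 \<le> cmod w" for w
    proof -
      have 2: "cmod w / 2 \<le> cmod (cnj z + w)"
        using norm_triangle_ineq2[of w "- cnj z"] w(2) by (simp add: add.commute)
      have w0: "0 < cmod w"
        using w(2) norm_ge_zero[of z] by linarith
      have "cmod (H w) * cmod w \<le> B"
        using bd[OF w(1)] by (rule order_trans[rotated]) (simp add: distrib_left)
      then have "cmod (H w) \<le> B / cmod w"
        using w0 by (simp add: field_simps)
      then have "cmod (\<phi> w) \<le> (B / cmod w) / (cmod w / 2)"
        unfolding \<phi>_def norm_divide using 2 w0 by (intro frac_le) (auto intro: order_trans[OF norm_ge_zero])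
      then show ?thesis
        using w0 by (simp add: power2_eq_square field_simps)
    qed
  qed
  then have "has_bochner_integral lborel (\<lambda>t. \<phi> (Complex 0 t) * (1 / (2 * complex_of_real pi)))
      (0 * (1 / (2 * complex_of_real pi)))"
    by (rule has_bochner_integral_mult_left)
  from has_bochner_integral_diff[OF poisson_formula[OF \<open>0 < d\<close> hol bd' z] this]
  have "has_bochner_integral lborel (\<lambda>t. poisson z t *\<^sub>R H (Complex 0 t) - \<phi> (Complex 0 t) * (1 / (2 * complex_of_real pi))) (H z)"
    by simp
  moreover have "poisson z t *\<^sub>R H (Complex 0 t) - \<phi> (Complex 0 t) * (1 / (2 * complex_of_real pi))
      = H (Complex 0 t) / (2 * pi * (z - Complex 0 t))" for t
  proof -
    define w where "w = Complex 0 t"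
    have ne: "z - w \<noteq> 0" "cnj z + w \<noteq> 0"
      using z by (auto simp: complex_eq_iff w_def)
    have n: "complex_of_real ((cmod (z - w))\<^sup>2) = (z - w) * (cnj z + w)"
      unfolding complex_norm_square by (simp add: complex_eq_iff w_def algebra_simps)
    have r: "complex_of_real (2 * Re z) = (z - w) + (cnj z + w)"
      by (simp add: complex_add_cnj)
    have "complex_of_real (poisson z t) = complex_of_real (2 * Re z) / (2 * pi * complex_of_real ((cmod (z - w))\<^sup>2))"
      by (simp add: poisson_def w_def)
    also have "\<dots> = ((z - w) + (cnj z + w)) / (2 * pi * ((z - w) * (cnj z + w)))"
      unfolding n r ..
    also have "\<dots> = 1 / (2 * pi * (cnj z + w)) + 1 / (2 * pi * (z - w))"
      using ne by (simp add: divide_simps)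
    finally show ?thesis
      using ne by (simp add: scaleR_conv_of_real \<phi>_def w_def[symmetric]  algebra_simps)
  qed
  ultimately show ?thesis
    by simp
qed

section \<open>Approximation on the unit circle by real parts of polynomials\<close>

text \<open>On the circle \<open>cnj w\<close> is the inverse of \<open>w\<close>. For a linear
  factor \<open>Re (a * w)\<close>, twice the product is the real part of
  \<open>a * w * poly p w + cnj a * cnj w * poly p w\<close>; there \<open>cnj w\<close> lowers
  every degree by one, and the leftover \<open>cnj a * c * cnj w\<close> from the constant
  coefficient is conjugated into a polynomial term. The arbitrary \<open>p\<close> in the claim
  makes the induction pass through products.\<close>

lemma real_polynomial_mult_Re_poly:
  fixes f :: "complex \<Rightarrow> real"
  assumes "real_polynomial_function f"
  shows "\<exists>q. \<forall>w. cmod w = 1 \<longrightarrow> f w * Re (poly p w) = Re (poly q w)"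
  using assms
proof (induction f arbitrary: p rule: real_polynomial_function.induct)
  case (linear f)
  define a where "a = Complex (f 1) (- f \<i>)"
  have f: "f w = Re (a * w)" for w
  proof -
    have "f w = f (Re w *\<^sub>R 1 + Im w *\<^sub>R \<i>)"
      by (rule arg_cong[where f=f]) (simp add: complex_eq_iff)
    also have "\<dots> = Re w * f 1 + Im w * f \<i>"
      using linear by (simp add: bounded_linear.linear linear_add linear_scale)
    finally show ?thesis
      by (simp add: a_def)
  qed
  obtain c p' where p: "p = pCons c p'"
    by (cases p)
  define q where "q = smult (1/2) (pCons 0 (smult a p) + [:0, a * cnj c:] + smult (cnj a) p')"
  have "f w * Re (poly p w) = Re (poly q w)" if "cmod w = 1" for w
  proof -
    have w: "cnj w * w = 1"
      using that complex_norm_square[of w] by (simp add: mult.commute)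
    have "cnj w * poly p w = c * cnj w + (cnj w * w) * poly p' w"
      by (simp add: p algebra_simps)
    then have 1: "cnj a * (cnj w * poly p w) = cnj a * c * cnj w + cnj a * poly p' w"
      unfolding w by (simp add: algebra_simps)
    have 2: "Re (cnj a * c * cnj w) = Re (a * cnj c * w)"
      by (simp add: algebra_simps)
    have "f w * Re (poly p w) = (1/2) * (Re (a * w * poly p w) + Re (cnj a * (cnj w * poly p w)))"
      unfolding f by (simp add: algebra_simps)
    also have "\<dots> = (1/2) * (Re (a * w * poly p w) + Re (a * cnj c * w) + Re (cnj a * poly p' w))"
      unfolding 1 by (simp only: plus_complex.sel 2 add.assoc)
    also have "\<dots> = (1/2) * Re (a * w * poly p w + a * cnj c * w + cnj a * poly p' w)"
      by (simp only: plus_complex.sel)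
    also have "a * w * poly p w + a * cnj c * w + cnj a * poly p' w
        = poly (pCons 0 (smult a p) + [:0, a * cnj c:] + smult (cnj a) p') w"
      by (simp add: algebra_simps)
    also have "(1/2) * Re \<dots> = Re (poly q w)"
      by (simp add: q_def)
    finally show ?thesis .
  qed
  then show ?case by blast
next
  case (const c)
  show ?case
    by (rule exI[of _ "smult (of_real c) p"]) simp
next
  case (add f g)
  from add.IH(1)[of p] add.IH(2)[of p] obtain q1 q2 where
    "\<forall>w. cmod w = 1 \<longrightarrow> f w * Re (poly p w) = Re (poly q1 w)"
    "\<forall>w. cmod w = 1 \<longrightarrow> g w * Re (poly p w) = Re (poly q2 w)"
    by blast
  then show ?case
    by (intro exI[of _ "q1 + q2"]) (simp add: distrib_right)
next
  case (mult f g)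
  from mult.IH(2)[of p] obtain q2 where 2: "\<forall>w. cmod w = 1 \<longrightarrow> g w * Re (poly p w) = Re (poly q2 w)"
    by blast
  from mult.IH(1)[of q2] obtain q1 where "\<forall>w. cmod w = 1 \<longrightarrow> f w * Re (poly q2 w) = Re (poly q1 w)"
    by blast
  with 2 show ?case
    by (intro exI[of _ q1]) (simp add: mult.assoc)
qed

text \<open>Stone-Weierstrass followed by the preceding lemma with \<open>p = 1\<close>. The point
  of real parts of complex polynomials is that their exponentials are moduli of zero-free
  holomorphic functions.\<close>

lemma Weierstrass_Re_poly_circle:
  fixes \<phi> :: "complex \<Rightarrow> real"
  assumes "continuous_on (sphere 0 1) \<phi>" "0 < e"
  obtains q where "\<And>w. cmod w = 1 \<Longrightarrow> \<bar>\<phi> w - Re (poly q w)\<bar> < e"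
proof -
  obtain f where f: "real_polynomial_function f" "\<And>w. w \<in> sphere 0 1 \<Longrightarrow> \<bar>\<phi> w - f w\<bar> < e"
    using Stone_Weierstrass_real_polynomial_function[OF compact_sphere assms] by blast
  obtain q where "\<forall>w. cmod w = 1 \<longrightarrow> f w * Re (poly 1 w) = Re (poly q w)"
    using real_polynomial_mult_Re_poly[OF f(1)] by blast
  with f(2) show ?thesis
    by (intro that[of q]) (metis mem_sphere_0 mult.right_neutral one_complex.sel(1) poly_1)
qed

section \<open>Subharmonicity of the square root of the modulus\<close>

text \<open>
  A zero-free \<open>H\<close> is chosen whose modulus on the boundary dominates \<open>\<bar>g\<bar>\<^sup>1\<^sup>/\<^sup>2\<close> but hardly exceeds it:
  \<open>H\<close> is the exponential of a polynomial in the Cayley transform \<open>(1 - z) / (1 + z)\<close>, whose real part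
  approximates the logarithm of the boundary data on the unit circle.  As \<open>g / H\<^sup>2\<close> is bounded by \<open>1\<close>
  on the boundary, the Poisson formula for \<open>H\<close> gives \<open>\<bar>g\<bar>\<^sup>1\<^sup>/\<^sup>2 \<le> \<bar>H\<bar> \<le> P[\<bar>H\<bar>]\<close>.
\<close>

lemma sqrt_norm_le_poisson:
  assumes "0 < d" and hol: "g holomorphic_on {z. - d < Re z}"
    and bd: "\<And>z. 0 \<le> Re z \<Longrightarrow> cmod (g z) * (1 + cmod z) \<le> C" and z: "0 < Re z"
  shows "sqrt (cmod (g z)) \<le> (LINT t|lborel. poisson z t * sqrt (cmod (g (Complex 0 t))))"
proof -
  have bd': "cmod (g w) \<le> C" if "0 \<le> Re w" for w
    using bd[OF that] by (rule order_trans[rotated]) (simp add: distrib_left)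
  have "0 \<le> C"
    by (rule order_trans[OF norm_ge_zero bd'[of 0]]) simp
  define \<gamma> where "\<gamma> w = (1 - w) / (1 + w)" for w :: complex
  \<comment> \<open>\<open>\<gamma>\<close> is its own inverse, so it serves both to pull boundary
    data back to the circle and to transplant the polynomial to the half plane.\<close>
  have \<gamma>\<gamma>: "\<gamma> (\<gamma> w) = w" if "w \<noteq> -1" for w
    using that by (simp add: \<gamma>_def divide_simps add_eq_0_iff)
  have \<gamma>_sphere: "Re (\<gamma> w) = 0" if "cmod w = 1" for w
  proof -
    have "w * cnj w = 1"
      using that complex_norm_square[of w] by simp
    then have "(Re w)\<^sup>2 + (Im w)\<^sup>2 = 1"
      using that by (simp add: cmod_def)
    then have "Re ((1 - w) * cnj (1 + w)) = 0"
      by (simp add: power2_eq_square algebra_simps)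
    moreover have "\<gamma> w = (1 - w) * cnj (1 + w) / of_real ((cmod (1 + w))\<^sup>2)"
      unfolding \<gamma>_def by (rule complex_div_cnj)
    ultimately show ?thesis
      by (metis Re_divide_of_real div_0)
  qed
  have \<gamma>_le: "cmod (\<gamma> w) \<le> 1" if "0 \<le> Re w" for w
  proof -
    have "(cmod (1 - w))\<^sup>2 \<le> (cmod (1 + w))\<^sup>2"
      using that unfolding cmod_power2 by (simp add: power2_eq_square algebra_simps)
    then have "cmod (1 - w) \<le> cmod (1 + w)"
      by (rule power2_le_imp_le) simp
    moreover have "1 + w \<noteq> 0"
      using that by (auto simp: complex_eq_iff)
    ultimately show ?thesis
      by (simp add: \<gamma>_def norm_divide)
  qed
  have \<gamma>_eq: "cmod (\<gamma> (Complex 0 t)) = 1" "\<gamma> (Complex 0 t) \<noteq> -1" for t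
  proof -
    have "cmod (1 - Complex 0 t) = cmod (1 + Complex 0 t)"
      by (simp add: cmod_def)
    moreover have ne: "1 + Complex 0 t \<noteq> 0"
      by (simp add: complex_eq_iff)
    ultimately show "cmod (\<gamma> (Complex 0 t)) = 1"
      by (simp add: \<gamma>_def norm_divide)
    show "\<gamma> (Complex 0 t) \<noteq> -1"
    proof
      assume "\<gamma> (Complex 0 t) = -1"
      then have "1 - Complex 0 t = - (1 + Complex 0 t)"
        unfolding \<gamma>_def using ne by (simp only: divide_eq_eq if_True not_False_eq_True mult_minus_left mult_1_left)
      then show False
        by simp
    qed
  qed
  have hol_\<gamma>: "\<gamma> holomorphic_on {z. - 1 < Re z}"
  proof -
    have "1 + w \<noteq> 0" if "- 1 < Re w" for w :: complex
      using that by (auto simp: complex_eq_iff)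
    then show ?thesis
      unfolding \<gamma>_def by (intro holomorphic_intros) auto
  qed
  define s where "s t = sqrt (cmod (g (Complex 0 t)))" for t
  have cont_s: "continuous_on UNIV s"
    unfolding s_def
    by (intro continuous_intros continuous_on_compose2[OF holomorphic_on_imp_continuous_on[OF hol]])
      (use \<open>0 < d\<close> in auto)
  then have [measurable]: "s \<in> borel_measurable borel"
    by (rule borel_measurable_continuous_onI)
  have s_le: "s t \<le> sqrt C" for t
    unfolding s_def using bd'[of "Complex 0 t"] by simp
  have s_nonneg: "0 \<le> s t" for t
    by (simp add: s_def)
  have int_P: "integrable lborel (poisson z)" "(LINT t|lborel. poisson z t) = 1"
    using has_bochner_integral_poisson[OF z] by (auto simp: has_bochner_integral_iff)
  have int_s: "integrable lborel (\<lambda>t. poisson z t * s t)"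
  proof (rule Bochner_Integration.integrable_bound[OF integrable_mult_left[OF int_P(1)] _ AE_I2])
    show "norm (poisson z t * s t) \<le> norm (poisson z t * sqrt C)" for t
      using poisson_nonneg[of z t] z s_le[of t] s_nonneg[of t] \<open>0 \<le> C\<close>
      by (simp add: abs_mult mult_left_mono)
  qed auto
  define S where "S = (LINT t|lborel. poisson z t * s t)"
  have key: "sqrt (cmod (g z)) \<le> exp (2 * \<eta>) * (S + \<eta>)" if "0 < \<eta>" for \<eta>
  proof -
    \<comment> \<open>The point \<open>-1\<close> corresponds to infinity, where the decay of
      \<open>g\<close> dictates the value \<open>0\<close>.\<close>
    define \<psi> where "\<psi> w = (if w = -1 then 0 else g (\<gamma> w))" for w
    \<comment> \<open>Decay of \<open>g\<close> at infinity becomes linear vanishing at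
      \<open>-1\<close>, because \<open>1 + cmod (\<gamma> w)\<close> is at least
      \<open>2 / cmod (1 + w)\<close>.\<close>
    have \<psi>_le: "cmod (\<psi> w) \<le> C * cmod (w - (-1)) / 2" if "cmod w = 1" for w
    proof (cases "w = -1")
      case False
      have p: "0 < cmod (1 + w)"
        using False by (simp add: add_eq_0_iff)
      have "2 \<le> cmod (1 + w) + cmod (1 - w)"
        using norm_triangle_ineq[of "1 + w" "1 - w"] by simp
      then have "2 / cmod (1 + w) \<le> 1 + cmod (\<gamma> w)"
        using p by (simp add: \<gamma>_def norm_divide field_simps)
      then have "cmod (g (\<gamma> w)) * (2 / cmod (1 + w)) \<le> cmod (g (\<gamma> w)) * (1 + cmod (\<gamma> w))"
        by (rule mult_left_mono) simp
      also have "\<dots> \<le> C"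
        using bd[of "\<gamma> w"] \<gamma>_sphere[OF that] by simp
      finally have "cmod (g (\<gamma> w)) * (2 / cmod (1 + w)) \<le> C" .
      then show ?thesis
        using False p by (simp add: \<psi>_def field_simps)
    qed (simp add: \<psi>_def)
    have cont_\<psi>: "continuous_on (sphere 0 1) \<psi>"
      unfolding continuous_on_eq_continuous_within
    proof
      fix w :: complex
      assume w: "w \<in> sphere 0 1"
      show "continuous (at w within sphere 0 1) \<psi>"
      proof (cases "w = -1")
        case True
        have "((\<lambda>w. C * cmod (w - (-1)) / 2) \<longlongrightarrow> C * cmod (-1 - (-1)) / 2) (at (-1) within sphere 0 1)"
          by (intro tendsto_intros) auto
        then have 0: "((\<lambda>w. C * cmod (w - (-1)) / 2) \<longlongrightarrow> 0) (at (-1) within sphere 0 1)"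
          by simp
        have "(\<psi> \<longlongrightarrow> 0) (at (-1) within sphere 0 1)"
          by (rule Lim_null_comparison[OF _ 0]) (use \<psi>_le in \<open>auto simp: eventually_at_filter\<close>)
        then show ?thesis
          unfolding True continuous_within by (simp add: \<psi>_def)
      next
        case False
        have "continuous (at w within sphere 0 1) (\<lambda>w. g (\<gamma> w))"
        proof -
          have "isCont \<gamma> w"
            unfolding \<gamma>_def using False by (intro continuous_intros) (auto simp: add_eq_0_iff)
          moreover have "\<gamma> w \<in> {z. - d < Re z}"
            using \<gamma>_sphere[of w] w \<open>0 < d\<close> by simp
          then have "isCont g (\<gamma> w)"
            using holomorphic_on_imp_continuous_on[OF hol]
              continuous_on_eq_continuous_at[OF open_halfspace_Re_gt] by blast
          ultimately have "isCont (\<lambda>w. g (\<gamma> w)) w"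
            by (rule isCont_o2)
          then show ?thesis
            by (rule continuous_at_imp_continuous_at_within)
        qed
        then have "((\<lambda>w. g (\<gamma> w)) \<longlongrightarrow> g (\<gamma> w)) (at w within sphere 0 1)"
          by (simp add: continuous_within)
        moreover have "\<forall>\<^sub>F x in at w within sphere 0 1. g (\<gamma> x) = \<psi> x"
        proof -
          have "\<forall>\<^sub>F x in nhds w. x \<noteq> -1"
            using False by (rule t1_space_nhds)
          then show ?thesis
            unfolding eventually_at_filter by eventually_elim (simp add: \<psi>_def)
        qed
        ultimately have "(\<psi> \<longlongrightarrow> g (\<gamma> w)) (at w within sphere 0 1)"
          by (rule Lim_transform_eventually)
        then show ?thesis
          using False by (simp add: continuous_within \<psi>_def)
      qed
    qed
    \<comment> \<open>The summand \<open>\<eta>\<close> keeps the logarithm finite at the zeros of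
      \<open>\<psi>\<close>, in particular at \<open>-1\<close>.\<close>
    have "0 < sqrt (cmod (\<psi> w)) + \<eta>" for w
      using \<open>0 < \<eta>\<close> by (simp add: add_nonneg_pos)
    then have "continuous_on (sphere 0 1) (\<lambda>w. ln (sqrt (cmod (\<psi> w)) + \<eta>))"
      by (intro continuous_intros cont_\<psi>) (metis less_irrefl)
    then obtain q where q: "\<And>w. cmod w = 1 \<Longrightarrow> \<bar>ln (sqrt (cmod (\<psi> w)) + \<eta>) - Re (poly q w)\<bar> < \<eta>"
      using Weierstrass_Re_poly_circle \<open>0 < \<eta>\<close> by blast
    \<comment> \<open>The \<open>\<eta>\<close> in the exponent outweighs the approximation error:
      on the axis \<open>cmod (H (Complex 0 t))\<close> lies between \<open>s t + \<eta>\<close> and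
      \<open>exp (2 * \<eta>) * (s t + \<eta>)\<close>.\<close>
    define H where "H z = exp (poly q (\<gamma> z) + \<eta>)" for z
    have "compact (poly q ` cball 0 1)"
      by (intro compact_continuous_image continuous_intros) auto
    then obtain K where K: "\<And>w. cmod w \<le> 1 \<Longrightarrow> cmod (poly q w) \<le> K"
      by (metis bounded_iff compact_imp_bounded imageI mem_cball_0)
    have normH: "cmod (H w) = exp (Re (poly q (\<gamma> w)) + \<eta>)" for w
      by (simp add: H_def)
    have ReK: "\<bar>Re (poly q (\<gamma> w))\<bar> \<le> K" if "0 \<le> Re w" for w
      using abs_Re_le_cmod K[OF \<gamma>_le[OF that]] by (rule order_trans)
    have bdH: "cmod (H w) \<le> exp (K + \<eta>)" if "0 \<le> Re w" for w
      using ReK[OF that] by (simp add: normH)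
    have hol_H: "H holomorphic_on {z. - 1 < Re z}"
      unfolding H_def poly_altdef by (intro holomorphic_intros hol_\<gamma>)
    have H_bounds: "s t \<le> cmod (H (Complex 0 t))" "cmod (H (Complex 0 t)) \<le> exp (2 * \<eta>) * (s t + \<eta>)" for t
    proof -
      let ?w = "\<gamma> (Complex 0 t)"
      have "Complex 0 t \<noteq> -1"
        by (simp add: complex_eq_iff)
      then have "sqrt (cmod (\<psi> ?w)) = s t"
        using \<gamma>_eq[of t] by (simp add: \<psi>_def \<gamma>\<gamma> s_def)
      then have a: "\<bar>ln (s t + \<eta>) - Re (poly q ?w)\<bar> < \<eta>"
        using q[of ?w] \<gamma>_eq[of t] by simp
      have p: "0 < s t + \<eta>"
        using s_nonneg[of t] \<open>0 < \<eta>\<close> by simp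
      have "s t + \<eta> = exp (ln (s t + \<eta>))"
        using p by simp
      also have "\<dots> \<le> cmod (H (Complex 0 t))"
        unfolding normH using a by simp
      finally show "s t \<le> cmod (H (Complex 0 t))"
        using \<open>0 < \<eta>\<close> by simp
      have "cmod (H (Complex 0 t)) \<le> exp (2 * \<eta> + ln (s t + \<eta>))"
        unfolding normH using a by simp
      also have "\<dots> = exp (2 * \<eta>) * (s t + \<eta>)"
        using p by (simp add: exp_add)
      finally show "cmod (H (Complex 0 t)) \<le> exp (2 * \<eta>) * (s t + \<eta>)" .
    qed
    \<comment> \<open>A maximum principle for a bounded function on an unbounded domain, read off
      from the Poisson formula; the quotient is holomorphic since an exponential has no
      zeros.\<close>
    have "cmod (g z / (H z)\<^sup>2) \<le> 1"
    proof -
      have "has_bochner_integral lborel (\<lambda>t. poisson z t *\<^sub>R (g (Complex 0 t) / (H (Complex 0 t))\<^sup>2)) (g z / (H z)\<^sup>2)"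
      proof (rule poisson_formula[where d = "min d 1" and H = "\<lambda>z. g z / (H z)\<^sup>2", OF _ _ _ z])
        show "(\<lambda>z. g z / (H z)\<^sup>2) holomorphic_on {z. - min d 1 < Re z}"
          by (intro holomorphic_intros holomorphic_on_subset[OF hol] holomorphic_on_subset[OF hol_H])
            (auto simp: H_def)
        show "cmod (g w / (H w)\<^sup>2) \<le> C / (exp (- K))\<^sup>2" if "0 \<le> Re w" for w
        proof -
          have "exp (- K) \<le> cmod (H w)"
            using ReK[OF that] \<open>0 < \<eta>\<close> by (simp add: normH abs_le_iff)
          then show ?thesis
            unfolding norm_divide norm_power using bd'[OF that] \<open>0 \<le> C\<close>
            by (intro frac_le power_mono) auto
        qed
      qed (use \<open>0 < d\<close> in auto)
      then have e: "g z / (H z)\<^sup>2 = (LINT t|lborel. poisson z t *\<^sub>R (g (Complex 0 t) / (H (Complex 0 t))\<^sup>2))"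
        and i: "integrable lborel (\<lambda>t. poisson z t *\<^sub>R (g (Complex 0 t) / (H (Complex 0 t))\<^sup>2))"
        by (auto simp: has_bochner_integral_iff)
      have "cmod (g z / (H z)\<^sup>2) \<le> (LINT t|lborel. poisson z t)"
        unfolding e
      proof (rule Bochner_Integration.integral_norm_bound_integral[OF i int_P(1)])
        fix t
        have "(s t)\<^sup>2 \<le> (cmod (H (Complex 0 t)))\<^sup>2"
          by (intro power_mono H_bounds s_nonneg)
        then have "cmod (g (Complex 0 t) / (H (Complex 0 t))\<^sup>2) \<le> 1"
          by (simp add: s_def norm_divide norm_power H_def)
        then show "norm (poisson z t *\<^sub>R (g (Complex 0 t) / (H (Complex 0 t))\<^sup>2)) \<le> poisson z t"
          unfolding norm_scaleR using poisson_nonneg[of z t] z by (simp add: mult_left_le)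
      qed
      then show ?thesis
        by (simp add: int_P)
    qed
    then have "cmod (g z) \<le> (cmod (H z))\<^sup>2"
      by (simp add: norm_divide norm_power H_def)
    then have "sqrt (cmod (g z)) \<le> cmod (H z)"
      by (metis real_sqrt_le_mono real_sqrt_unique norm_ge_zero)
    also have "\<dots> \<le> (LINT t|lborel. exp (2 * \<eta>) * (poisson z t * s t) + exp (2 * \<eta>) * \<eta> * poisson z t)"
    proof -
      have hb: "has_bochner_integral lborel (\<lambda>t. poisson z t *\<^sub>R H (Complex 0 t)) (H z)"
        by (rule poisson_formula[OF _ hol_H bdH z]) auto
      then have "H z = (LINT t|lborel. poisson z t *\<^sub>R H (Complex 0 t))"
        by (simp add: has_bochner_integral_iff)
      then show ?thesis
      proof (simp only:, intro Bochner_Integration.integral_norm_bound_integral)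
        show "norm (poisson z t *\<^sub>R H (Complex 0 t))
          \<le> exp (2 * \<eta>) * (poisson z t * s t) + exp (2 * \<eta>) * \<eta> * poisson z t" for t
          using mult_left_mono[OF H_bounds(2)[of t] poisson_nonneg[of z t]] poisson_nonneg[of z t] z
          by (simp add: algebra_simps)
      qed (use hb int_s int_P in \<open>auto simp: has_bochner_integral_iff\<close>)
    qed
    also have "\<dots> = exp (2 * \<eta>) * (S + \<eta>)"
      using int_s int_P by (simp add: S_def distrib_left)
    finally show ?thesis .
  qed
  have "((\<lambda>\<eta>. exp (2 * \<eta>) * (S + \<eta>)) \<longlongrightarrow> exp (2 * 0) * (S + 0)) (at_right 0)"
    by (intro tendsto_intros)
  moreover have "\<forall>\<^sub>F \<eta> in at_right 0. sqrt (cmod (g z)) \<le> exp (2 * \<eta>) * (S + \<eta>)"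
    using key by (auto simp: eventually_at_right_field intro: exI[of _ 1])
  ultimately have "sqrt (cmod (g z)) \<le> exp (2 * 0) * (S + 0)"
    by (rule tendsto_lowerbound) simp
  then show ?thesis
    by (simp add: S_def s_def)
qed

section \<open>Hardy spaces on the half plane\<close>

text \<open>The kernel depends on \<open>v\<close> and \<open>t\<close> only through
  \<open>(t - v)\<^sup>2\<close>. This lets it be integrated over \<open>v\<close> with
  \<open>t\<close> fixed.\<close>

lemma poisson_commute: "poisson (Complex u v) t = poisson (Complex u t) v"
  by (simp add: poisson_def norm_diff_Complex_0 power2_commute[of t v])

lemma norm_cauchy_kernel_le:
  assumes "0 < Re z"
  shows "cmod (1 / (2 * pi * (z - Complex 0 t))) \<le> 1 / (2 * pi * Re z)"
proof -
  have "Re z \<le> cmod (z - Complex 0 t)"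
    using complex_Re_le_cmod[of "z - Complex 0 t"] by simp
  then have "1 / (2 * pi * cmod (z - Complex 0 t)) \<le> 1 / (2 * pi * Re z)"
    using assms by (intro divide_left_mono mult_pos_pos mult_left_mono) auto
  moreover have "cmod (1 / (2 * pi * w)) = 1 / (2 * pi * cmod w)" for w :: complex
    by (simp add: norm_divide norm_mult)
  ultimately show ?thesis
    by simp
qed

text \<open>Fatou's lemma; it carries bounds on vertical lines over to the boundary
  function.\<close>

lemma nn_integral_le_of_AE_tendsto:
  fixes f :: "nat \<Rightarrow> 'a \<Rightarrow> ennreal"
  assumes "\<And>n. f n \<in> borel_measurable M" "\<And>n. (\<integral>\<^sup>+ x. f n x \<partial>M) \<le> B"
    and "AE x in M. (\<lambda>n. f n x) \<longlonglongrightarrow> F x"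
  shows "(\<integral>\<^sup>+ x. F x \<partial>M) \<le> B"
proof -
  have "(\<integral>\<^sup>+ x. F x \<partial>M) = (\<integral>\<^sup>+ x. liminf (\<lambda>n. f n x) \<partial>M)"
    using assms(3)
    by (intro nn_integral_cong_AE, eventually_elim) (rule lim_imp_Liminf[OF sequentially_bot, symmetric])
  also have "\<dots> \<le> liminf (\<lambda>n. \<integral>\<^sup>+ x. f n x \<partial>M)"
    by (rule nn_integral_liminf) (rule assms)
  also have "\<dots> \<le> limsup (\<lambda>n. \<integral>\<^sup>+ x. f n x \<partial>M)"
    by (rule Liminf_le_Limsup) simp
  also have "\<dots> \<le> B"
    by (rule Limsup_bounded) (simp add: assms)
  finally show ?thesis .
qed

lemma integrable_poisson_mult:
  fixes h :: "real \<Rightarrow> real"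
  assumes z: "0 < Re z" and h: "integrable lborel h"
  shows "integrable lborel (\<lambda>t. poisson z t * h t)"
proof (rule Bochner_Integration.integrable_bound[OF integrable_mult_right[OF h] _ AE_I2])
  show "(\<lambda>t. poisson z t * h t) \<in> borel_measurable lborel"
    using h by measurable
  show "norm (poisson z t * h t) \<le> norm (1 / (pi * Re z) * h t)" for t
    unfolding norm_mult using poisson_le[OF z, of t] poisson_nonneg[of z t] z
    by (intro mult_right_mono) auto
qed

text \<open>A square root is at most one plus its radicand, and the kernel is integrable both alone
  and against \<open>cmod (h t)\<close>.\<close>

lemma integrable_poisson_sqrt:
  assumes z: "0 < Re z" and h: "integrable lborel h"
  shows "integrable lborel (\<lambda>t. poisson z t * sqrt (cmod (h t)))"
proof (rule Bochner_Integration.integrable_bound[OF _ _ AE_I2])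
  show "integrable lborel (\<lambda>t. poisson z t + poisson z t * cmod (h t))"
    using has_bochner_integral_poisson[OF z, THEN integrable.intros]
      integrable_poisson_mult[OF z integrable_norm[OF h]] by (rule Bochner_Integration.integrable_add)
  show "(\<lambda>t. poisson z t * sqrt (cmod (h t))) \<in> borel_measurable lborel"
    using h by measurable
  fix t
  have "sqrt (cmod (h t)) \<le> 1 + cmod (h t)"
    by (rule real_le_lsqrt) (auto simp: power2_eq_square algebra_simps)
  then have "poisson z t * sqrt (cmod (h t)) \<le> poisson z t * (1 + cmod (h t))"
    using poisson_nonneg[of z t] z by (intro mult_left_mono) auto
  then show "norm (poisson z t * sqrt (cmod (h t))) \<le> norm (poisson z t + poisson z t * cmod (h t))"
    using poisson_nonneg[of z t] z by (simp add: abs_mult distrib_left)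
qed

section \<open>The Cauchy formula in the case of exponent 1\<close>

text \<open>A working form of \<open>H\<^sup>1\<close>: \<open>decay\<close> brings the shifted
  functions within reach of the Poisson and Cauchy formulas, and \<open>gs\<close> is tied to
  \<open>g\<close> only almost everywhere and along one sequence of vertical lines.\<close>

locale hardy_one =
  fixes g :: "complex \<Rightarrow> complex" and gs :: "real \<Rightarrow> complex" and M :: real
  assumes M_nonneg: "0 \<le> M"
    and hol: "g holomorphic_on {z. 0 < Re z}"
    and M: "\<And>u. 0 < u \<Longrightarrow> (\<integral>\<^sup>+ t. norm (g (Complex u t)) \<partial>lborel) \<le> ennreal M"
    and decay: "\<And>e. 0 < e \<Longrightarrow> \<exists>C. \<forall>z. e \<le> Re z \<longrightarrow> cmod (g z) * (1 + cmod z) \<le> C"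
    and gs_measurable [measurable]: "gs \<in> borel_measurable borel"
    and lim: "AE t in lborel. (\<lambda>n. g (Complex (inverse (Suc n)) t)) \<longlonglongrightarrow> gs t"
begin

text \<open>A move to the right makes the function holomorphic across the axis; its axis values are
  those of \<open>g\<close> on a vertical line.\<close>

definition shift :: "nat \<Rightarrow> complex \<Rightarrow> complex" where
  "shift n z = g (z + of_real (inverse (Suc n)))"

lemma shift_axis: "shift n (Complex 0 t) = g (Complex (inverse (Suc n)) t)"
proof -
  have "Complex 0 t + of_real r = Complex r t" for r
    by (simp add: complex_eq_iff)
  then show ?thesis
    by (simp only: shift_def)
qed

lemma shift_holomorphic: "shift n holomorphic_on {z. - inverse (Suc n) < Re z}"
proof -
  define r :: real where "r = inverse (Suc n)"
  show ?thesis
    unfolding shift_def r_def[symmetric]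
    by (intro holomorphic_on_compose_gen[OF _ hol, unfolded o_def] holomorphic_intros) auto
qed

lemma shift_decay:
  obtains C where "\<And>z. 0 \<le> Re z \<Longrightarrow> cmod (shift n z) * (1 + cmod z) \<le> C"
proof -
  define e :: real where "e = inverse (Suc n)"
  have shift: "shift n z = g (z + of_real e)" and "0 < e" for z
    by (simp_all add: shift_def e_def)
  obtain C where C: "\<And>z. e \<le> Re z \<Longrightarrow> cmod (g z) * (1 + cmod z) \<le> C"
    using decay[of e] \<open>0 < e\<close> by auto
  have "cmod (shift n z) * (1 + cmod z) \<le> C" if "0 \<le> Re z" for z
  proof -
    have "(cmod z)\<^sup>2 \<le> (cmod (z + of_real e))\<^sup>2"
      unfolding cmod_power2 using that \<open>0 < e\<close> by (simp add: power_mono)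
    then have "cmod z \<le> cmod (z + of_real e)"
      by (rule power2_le_imp_le) simp
    then have "cmod (shift n z) * (1 + cmod z) \<le> cmod (shift n z) * (1 + cmod (z + of_real e))"
      by (intro mult_left_mono) auto
    also have "\<dots> \<le> C"
      unfolding shift by (rule C) (use that in simp)
    finally show ?thesis .
  qed
  then show ?thesis
    by (rule that)
qed

lemma shift_measurable [measurable]: "(\<lambda>t. shift n (Complex 0 t)) \<in> borel_measurable borel"
  by (intro borel_measurable_continuous_onI
      continuous_on_compose2[OF holomorphic_on_imp_continuous_on[OF shift_holomorphic[of n]]])
    (auto intro!: continuous_intros)

lemma shift_nn_integral: "(\<integral>\<^sup>+ t. norm (shift n (Complex 0 t)) \<partial>lborel) \<le> ennreal M"
  unfolding shift_axis by (rule M) simp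

lemma shift_integrable: "integrable lborel (\<lambda>t. shift n (Complex 0 t))"
  using shift_nn_integral[of n] by (auto simp: integrable_iff_bounded top_unique intro: le_less_trans)

lemma shift_tendsto:
  assumes "0 < Re z"
  shows "(\<lambda>n. shift n z) \<longlonglongrightarrow> g z"
proof -
  have "isCont g z"
    using holomorphic_on_imp_continuous_on[OF hol] assms
      continuous_on_eq_continuous_at[OF open_halfspace_Re_gt[of 0]] by blast
  moreover have "(\<lambda>n. z + of_real (inverse (Suc n))) \<longlonglongrightarrow> z + of_real 0"
    by (intro tendsto_intros LIMSEQ_inverse_real_of_nat)
  then have "(\<lambda>n. z + of_real (inverse (Suc n))) \<longlonglongrightarrow> z"
    by simp
  ultimately show ?thesis
    unfolding shift_def by (rule isCont_tendsto_compose)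
qed

lemma boundary_nn_integral: "(\<integral>\<^sup>+ t. norm (gs t) \<partial>lborel) \<le> ennreal M"
proof (rule nn_integral_le_of_AE_tendsto[OF _ shift_nn_integral])
  show "AE t in lborel. (\<lambda>n. ennreal (norm (shift n (Complex 0 t)))) \<longlonglongrightarrow> ennreal (norm (gs t))"
    using lim by eventually_elim (unfold shift_axis, intro tendsto_ennrealI tendsto_norm)
qed simp

lemma boundary_integrable: "integrable lborel gs"
  using boundary_nn_integral by (auto simp: integrable_iff_bounded top_unique intro: le_less_trans)

text \<open>Almost everywhere convergence with a bound on the squares suffices for this inequality:
  truncating at \<open>K\<close> costs at most \<open>1 / K\<close> times the bound, as \<open>a \<le> min a K + a\<^sup>2 / K\<close>.\<close>

lemma sqrt_norm_le_poisson_boundary: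
  assumes z: "0 < Re z"
  shows "sqrt (cmod (g z)) \<le> (LINT t|lborel. poisson z t * sqrt (cmod (gs t)))"
proof -
  \<comment> \<open>Since the kernel is at most \<open>1 / (pi * Re z)\<close>, this bounds the
    Poisson integral of \<open>cmod (shift n (Complex 0 t))\<close> for all \<open>n\<close> at
    once.\<close>
  define D where "D = M / (pi * Re z)"
  define S where "S = (LINT t|lborel. poisson z t * sqrt (cmod (gs t)))"
  have P: "0 \<le> poisson z t" for t
    using z by (simp add: poisson_nonneg)
  have key: "sqrt (cmod (g z)) \<le> S + D / K" if "0 < K" for K
  proof -
    define m where "m n t = poisson z t * min (sqrt (cmod (shift n (Complex 0 t)))) K" for n t
    have intP: "integrable lborel (\<lambda>t. poisson z t * K)"
      using has_bochner_integral_poisson[OF z] by (auto simp: has_bochner_integral_iff)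
    have m_meas [measurable]: "m n \<in> borel_measurable borel" for n
      unfolding m_def by measurable
    have m_bd: "norm (m n t) \<le> poisson z t * K" for n t
      unfolding m_def using P[of t] \<open>0 < K\<close> by (simp add: abs_mult mult_left_mono)
    have intm: "integrable lborel (m n)" for n
      by (rule Bochner_Integration.integrable_bound[OF intP _ AE_I2])
        (simp, unfold real_norm_def[of "poisson z _ * K"], rule order_trans[OF m_bd abs_ge_self])
    \<comment> \<open>Truncation provides the majorant \<open>poisson z t * K\<close>, independent
      of \<open>n\<close>.\<close>
    have "(\<lambda>n. LINT t|lborel. m n t) \<longlonglongrightarrow> (LINT t|lborel. poisson z t * min (sqrt (cmod (gs t))) K)"
    proof (rule integral_dominated_convergence[OF _ _ intP])
      show "AE t in lborel. (\<lambda>n. m n t) \<longlonglongrightarrow> poisson z t * min (sqrt (cmod (gs t))) K"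
        using lim by eventually_elim (auto simp: m_def shift_axis intro!: tendsto_intros)
    qed (use m_bd in auto)
    then have "(\<lambda>n. (LINT t|lborel. m n t) + D / K)
        \<longlonglongrightarrow> (LINT t|lborel. poisson z t * min (sqrt (cmod (gs t))) K) + D / K"
      by (intro tendsto_intros)
    moreover have "(\<lambda>n. sqrt (cmod (shift n z))) \<longlonglongrightarrow> sqrt (cmod (g z))"
      by (intro tendsto_intros shift_tendsto z)
    moreover have "sqrt (cmod (shift n z)) \<le> (LINT t|lborel. m n t) + D / K" for n
    proof -
      obtain C where C: "\<And>z. 0 \<le> Re z \<Longrightarrow> cmod (shift n z) * (1 + cmod z) \<le> C"
        using shift_decay[of n] by blast
      have int1: "integrable lborel (\<lambda>t. poisson z t * cmod (shift n (Complex 0 t)))"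
        by (intro integrable_poisson_mult z integrable_norm shift_integrable)
      have "sqrt (cmod (shift n z)) \<le> (LINT t|lborel. poisson z t * sqrt (cmod (shift n (Complex 0 t))))"
        by (rule sqrt_norm_le_poisson[OF _ shift_holomorphic C z]) auto
      also have "\<dots> \<le> (LINT t|lborel. m n t + (1 / K) * (poisson z t * cmod (shift n (Complex 0 t))))"
      proof (rule integral_mono)
        show "integrable lborel (\<lambda>t. poisson z t * sqrt (cmod (shift n (Complex 0 t))))"
          by (intro integrable_poisson_sqrt z shift_integrable)
        show "integrable lborel (\<lambda>t. m n t + (1 / K) * (poisson z t * cmod (shift n (Complex 0 t))))"
          by (intro Bochner_Integration.integrable_add intm integrable_mult_right int1)
        fix t
        define a where "a = sqrt (cmod (shift n (Complex 0 t)))"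
        have a: "0 \<le> a" "cmod (shift n (Complex 0 t)) = a * a"
          by (simp_all add: a_def)
        have "a \<le> min a K + a * a / K"
        proof (cases "a \<le> K")
          case False
          then have "a * K \<le> a * a"
            using a(1) by (intro mult_left_mono) auto
          then have "a \<le> a * a / K"
            using \<open>0 < K\<close> by (simp add: pos_le_divide_eq)
          then show ?thesis
            using \<open>0 < K\<close> a(1) by (simp add: min_def)
        qed (use \<open>0 < K\<close> a(1) in simp)
        then have "poisson z t * a \<le> poisson z t * (min a K + a * a / K)"
          by (rule mult_left_mono[OF _ P])
        then show "poisson z t * sqrt (cmod (shift n (Complex 0 t)))
            \<le> m n t + (1 / K) * (poisson z t * cmod (shift n (Complex 0 t)))"
          unfolding m_def a_def[symmetric] a(2) using a(1) by (simp add: distrib_left)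
      qed
      also have "\<dots> = (LINT t|lborel. m n t) + (1 / K) * (LINT t|lborel. poisson z t * cmod (shift n (Complex 0 t)))"
        using intm int1 by simp
      also have "(LINT t|lborel. poisson z t * cmod (shift n (Complex 0 t))) \<le> D"
      proof -
        have i: "integrable lborel (\<lambda>t. cmod (shift n (Complex 0 t)))"
          by (intro integrable_norm shift_integrable)
        have "ennreal (LINT t|lborel. cmod (shift n (Complex 0 t))) \<le> ennreal M"
          using shift_nn_integral[of n] nn_integral_eq_integral[OF i] by simp
        then have "(LINT t|lborel. cmod (shift n (Complex 0 t))) \<le> M"
          using M_nonneg by (simp add: ennreal_le_iff)
        moreover have "(LINT t|lborel. poisson z t * cmod (shift n (Complex 0 t)))
            \<le> (LINT t|lborel. 1 / (pi * Re z) * cmod (shift n (Complex 0 t)))"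
          using int1 i by (intro integral_mono mult_right_mono poisson_le z integrable_mult_right) auto
        ultimately show ?thesis
          using z by (simp add: D_def divide_right_mono order_trans)
      qed
      finally show ?thesis
        using \<open>0 < K\<close> by (simp add: divide_right_mono)
    qed
    ultimately have "sqrt (cmod (g z)) \<le> (LINT t|lborel. poisson z t * min (sqrt (cmod (gs t))) K) + D / K"
      using LIMSEQ_le by blast
    also have "(LINT t|lborel. poisson z t * min (sqrt (cmod (gs t))) K) \<le> S"
      unfolding S_def
    proof (rule integral_mono)
      show "integrable lborel (\<lambda>t. poisson z t * min (sqrt (cmod (gs t))) K)"
        by (rule Bochner_Integration.integrable_bound[OF intP _ AE_I2])
          (use P \<open>0 < K\<close> in \<open>auto simp: abs_mult mult_left_mono\<close>)
      show "integrable lborel (\<lambda>t. poisson z t * sqrt (cmod (gs t)))"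
        by (intro integrable_poisson_sqrt z boundary_integrable)
    qed (use P in \<open>auto intro: mult_left_mono\<close>)
    finally show ?thesis
      by simp
  qed
  have "((\<lambda>K. S + D / K) \<longlongrightarrow> S + 0) at_top"
    by (intro tendsto_add tendsto_const real_tendsto_divide_at_top[OF tendsto_const] filterlim_ident)
  moreover have "\<forall>\<^sub>F K in at_top. sqrt (cmod (g z)) \<le> S + D / K"
    using eventually_gt_at_top[of 0] by eventually_elim (rule key)
  ultimately have "sqrt (cmod (g z)) \<le> S + 0"
    by (rule tendsto_lowerbound) simp
  then show ?thesis
    by (simp add: S_def)
qed

text \<open>Jensen's inequality for squaring under the probability density \<open>poisson z\<close>.
  With \<open>c\<close> the mean of the square root, it follows by integrating
  \<open>2 * c * s \<le> s\<^sup>2 + c\<^sup>2\<close>.\<close>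

lemma norm_le_poisson_boundary:
  assumes z: "0 < Re z"
  shows "cmod (g z) \<le> (LINT t|lborel. poisson z t * cmod (gs t))"
proof -
  define c where "c = (LINT t|lborel. poisson z t * sqrt (cmod (gs t)))"
  have int: "integrable lborel (\<lambda>t. poisson z t * sqrt (cmod (gs t)))"
    "integrable lborel (\<lambda>t. poisson z t * cmod (gs t))" "integrable lborel (poisson z)"
    using integrable_poisson_sqrt[OF z boundary_integrable] has_bochner_integral_poisson[OF z]
      integrable_poisson_mult[OF z integrable_norm[OF boundary_integrable]]
    by (auto simp: has_bochner_integral_iff)
  have "2 * c * c = (LINT t|lborel. (2 * c) * (poisson z t * sqrt (cmod (gs t))))"
    by (simp add: c_def)
  also have "\<dots> \<le> (LINT t|lborel. poisson z t * cmod (gs t) + c\<^sup>2 * poisson z t)"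
  proof (rule integral_mono)
    fix t
    have "2 * c * sqrt (cmod (gs t)) \<le> (sqrt (cmod (gs t)))\<^sup>2 + c\<^sup>2"
      using sum_squares_ge_zero[of "sqrt (cmod (gs t)) - c" 0]
      by (simp add: power2_eq_square algebra_simps)
    then have "poisson z t * (2 * c * sqrt (cmod (gs t))) \<le> poisson z t * ((sqrt (cmod (gs t)))\<^sup>2 + c\<^sup>2)"
      using z by (intro mult_left_mono poisson_nonneg) auto
    then show "(2 * c) * (poisson z t * sqrt (cmod (gs t))) \<le> poisson z t * cmod (gs t) + c\<^sup>2 * poisson z t"
      by (simp add: algebra_simps)
  qed (use int in auto)
  also have "\<dots> = (LINT t|lborel. poisson z t * cmod (gs t)) + c\<^sup>2"
    using int has_bochner_integral_poisson[OF z] by (simp add: has_bochner_integral_iff)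
  finally have "c\<^sup>2 \<le> (LINT t|lborel. poisson z t * cmod (gs t))"
    by (simp add: power2_eq_square)
  moreover have "cmod (g z) = (sqrt (cmod (g z)))\<^sup>2"
    by simp
  moreover have "\<dots> \<le> c\<^sup>2"
    unfolding c_def by (intro power_mono sqrt_norm_le_poisson_boundary z) simp
  ultimately show ?thesis
    by simp
qed

text \<open>Integrate the pointwise Poisson bound over \<open>v\<close> and exchange the integrals:
  by symmetry the kernel also has mass \<open>1\<close> in \<open>v\<close>.\<close>

lemma nn_integral_le_boundary:
  assumes u: "0 < u"
  shows "(\<integral>\<^sup>+ v. norm (g (Complex u v)) \<partial>lborel) \<le> (\<integral>\<^sup>+ t. norm (gs t) \<partial>lborel)"
proof -
  have "(\<integral>\<^sup>+ v. norm (g (Complex u v)) \<partial>lborel)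
      \<le> (\<integral>\<^sup>+ v. (\<integral>\<^sup>+ t. ennreal (poisson (Complex u v) t * norm (gs t)) \<partial>lborel) \<partial>lborel)"
  proof (rule nn_integral_mono)
    fix v
    have "(\<integral>\<^sup>+ t. ennreal (poisson (Complex u v) t * norm (gs t)) \<partial>lborel)
        = ennreal (LINT t|lborel. poisson (Complex u v) t * norm (gs t))"
      by (intro nn_integral_eq_integral integrable_poisson_mult integrable_norm boundary_integrable AE_I2)
        (use u in \<open>auto simp: poisson_nonneg\<close>)
    then show "ennreal (norm (g (Complex u v)))
        \<le> (\<integral>\<^sup>+ t. ennreal (poisson (Complex u v) t * norm (gs t)) \<partial>lborel)"
      using norm_le_poisson_boundary[of "Complex u v"] u by (simp add: ennreal_leI)
  qed
  also have "\<dots> = (\<integral>\<^sup>+ t. (\<integral>\<^sup>+ v. ennreal (poisson (Complex u v) t * norm (gs t)) \<partial>lborel) \<partial>lborel)"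
    by (rule lborel_pair.Fubini'[symmetric]) (simp add: poisson_def)
  also have "\<dots> = (\<integral>\<^sup>+ t. norm (gs t) \<partial>lborel)"
  proof (rule nn_integral_cong)
    fix t
    have "(\<integral>\<^sup>+ v. ennreal (poisson (Complex u v) t * norm (gs t)) \<partial>lborel)
        = (\<integral>\<^sup>+ v. ennreal (poisson (Complex u t) v) * ennreal (norm (gs t)) \<partial>lborel)"
      using u by (intro nn_integral_cong) (simp add: poisson_commute[of u t] ennreal_mult poisson_nonneg)
    also have "\<dots> = (\<integral>\<^sup>+ v. ennreal (poisson (Complex u t) v) \<partial>lborel) * ennreal (norm (gs t))"
      by (rule nn_integral_multc) simp
    also have "(\<integral>\<^sup>+ v. ennreal (poisson (Complex u t) v) \<partial>lborel) = ennreal 1"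
      using has_bochner_integral_poisson[of "Complex u t"] u
      by (subst nn_integral_eq_integral) (auto simp: has_bochner_integral_iff poisson_nonneg)
    finally show "(\<integral>\<^sup>+ v. ennreal (poisson (Complex u v) t * norm (gs t)) \<partial>lborel) = ennreal (norm (gs t))"
      by simp
  qed
  finally show ?thesis .
qed

text \<open>The norms of the approximants never exceed that of their almost everywhere limit, which
  rules out concentration of mass on null sets.\<close>

lemma shift_tendsto_L1: "(\<lambda>n. \<integral>\<^sup>+ t. norm (shift n (Complex 0 t) - gs t) \<partial>lborel) \<longlonglongrightarrow> 0"
proof (rule Scheffe_lemma2)
  show "(\<integral>\<^sup>+ t. norm (shift n (Complex 0 t)) \<partial>lborel) \<le> (\<integral>\<^sup>+ t. norm (gs t) \<partial>lborel)" for n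
    unfolding shift_axis by (rule nn_integral_le_boundary) simp
  show "AE t in lborel. (\<lambda>n. shift n (Complex 0 t)) \<longlonglongrightarrow> gs t"
    unfolding shift_axis by (rule lim)
qed (simp_all add: boundary_integrable)

text \<open>For fixed \<open>z\<close> the Cauchy kernel is bounded on the axis, so the formula for
  each \<open>shift n\<close> passes to the limit under convergence in
  \<open>L\<^sup>1\<close>.\<close>

lemma cauchy_integral:
  assumes z: "0 < Re z"
  shows "has_bochner_integral lborel (\<lambda>t. gs t / (2 * pi * (z - Complex 0 t))) (g z)"
proof -
  define k where "k t = 1 / (2 * pi * (z - Complex 0 t))" for t
  define B where "B = 1 / (2 * pi * Re z)"
  have kB: "cmod (k t) \<le> B" for t
    unfolding k_def B_def by (rule norm_cauchy_kernel_le[OF z])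
  have [measurable]: "k \<in> borel_measurable borel"
    unfolding k_def by measurable
  have int: "integrable lborel (\<lambda>t. h t * k t)" if "integrable lborel h" for h :: "real \<Rightarrow> complex"
  proof (rule Bochner_Integration.integrable_bound[OF integrable_mult_left[OF integrable_norm[OF that]] _ AE_I2])
    show "(\<lambda>t. h t * k t) \<in> borel_measurable lborel"
      using that by measurable
    show "norm (h t * k t) \<le> norm (norm (h t) * B)" for t
      using kB[of t] by (simp add: norm_mult mult_left_mono abs_mult order_trans[OF _ abs_ge_self])
  qed
  have 1: "(\<lambda>n. shift n z) \<longlonglongrightarrow> (LINT t|lborel. gs t * k t)"
  proof (rule LIM_zero_cancel, rule Lim_null_comparison)
    show "\<forall>\<^sub>F n in sequentially. norm (shift n z - (LINT t|lborel. gs t * k t))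
        \<le> enn2real (\<integral>\<^sup>+ t. norm (shift n (Complex 0 t) - gs t) \<partial>lborel) * B"
    proof (rule always_eventually, rule allI)
      fix n
      obtain C where C: "\<And>z. 0 \<le> Re z \<Longrightarrow> cmod (shift n z) * (1 + cmod z) \<le> C"
        using shift_decay[of n] by blast
      have "has_bochner_integral lborel (\<lambda>t. shift n (Complex 0 t) / (2 * pi * (z - Complex 0 t))) (shift n z)"
        by (rule cauchy_formula[OF _ shift_holomorphic C z]) auto
      then have "shift n z = (LINT t|lborel. shift n (Complex 0 t) * k t)"
        by (simp add: has_bochner_integral_iff k_def)
      then have "shift n z - (LINT t|lborel. gs t * k t) = (LINT t|lborel. (shift n (Complex 0 t) - gs t) * k t)"
        using int[OF shift_integrable[of n]] int[OF boundary_integrable] by (simp add: left_diff_distrib)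
      moreover have "norm (LINT t|lborel. (shift n (Complex 0 t) - gs t) * k t)
          \<le> (LINT t|lborel. norm (shift n (Complex 0 t) - gs t) * B)"
        by (intro Bochner_Integration.integral_norm_bound_integral int integrable_mult_left integrable_norm
            Bochner_Integration.integrable_diff shift_integrable boundary_integrable)
          (simp add: norm_mult mult_left_mono kB)
      moreover have "(LINT t|lborel. norm (shift n (Complex 0 t) - gs t))
          = enn2real (\<integral>\<^sup>+ t. norm (shift n (Complex 0 t) - gs t) \<partial>lborel)"
        by (rule integral_eq_nn_integral) auto
      ultimately show "norm (shift n z - (LINT t|lborel. gs t * k t))
          \<le> enn2real (\<integral>\<^sup>+ t. norm (shift n (Complex 0 t) - gs t) \<partial>lborel) * B"
        by simp
    qed
    have "(\<lambda>n. enn2real (\<integral>\<^sup>+ t. norm (shift n (Complex 0 t) - gs t) \<partial>lborel)) \<longlonglongrightarrow> 0"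
      by (rule tendsto_enn2real) (simp_all add: shift_tendsto_L1)
    then show "(\<lambda>n. enn2real (\<integral>\<^sup>+ t. norm (shift n (Complex 0 t) - gs t) \<partial>lborel) * B) \<longlonglongrightarrow> 0"
      by (simp add: tendsto_mult_left_zero)
  qed
  have "g z = (LINT t|lborel. gs t * k t)"
    by (rule LIMSEQ_unique[OF shift_tendsto[OF z] 1])
  then show ?thesis
    using int[OF boundary_integrable] by (simp add: has_bochner_integral_iff k_def)
qed

end

section \<open>Reduction of exponents between 1 and 2 to exponent 1\<close>

text \<open>A crude replacement for Hoelder's inequality that serves all these exponents at once: a
  \<open>p\<close>-integrable function times a square integrable one bounded by \<open>1\<close> is
  integrable. If \<open>b < a\<close>, then
  \<open>b \<le> b powr (p - 1) \<le> a powr (p - 1)\<close>, as \<open>b \<le> 1\<close> and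
  \<open>p - 1 \<le> 1\<close>.\<close>

lemma mult_le_powr_add_square:
  fixes a b p :: real
  assumes p: "1 \<le> p" "p \<le> 2" and "0 \<le> a" "0 \<le> b" "b \<le> 1"
  shows "a * b \<le> a powr p + b\<^sup>2"
proof (cases "a \<le> b")
  case True
  then have "a * b \<le> b\<^sup>2"
    using assms by (simp add: power2_eq_square mult_right_mono)
  then show ?thesis
    by (simp add: add_increasing)
next
  case False
  then have "0 < a"
    using assms by simp
  have "b \<le> a powr (p - 1)"
  proof (cases "b = 0")
    case False
    then have "b powr 1 \<le> b powr (p - 1)"
      using assms by (intro powr_mono') auto
    also have "\<dots> \<le> a powr (p - 1)"
      using \<open>\<not> a \<le> b\<close> assms by (intro powr_mono2) auto
    finally show ?thesis
      using assms False by simp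
  qed simp
  then have "a * b \<le> a * a powr (p - 1)"
    using assms by (intro mult_left_mono) auto
  also have "\<dots> = a powr p"
    using \<open>0 < a\<close> powr_mult_base[of a "p - 1"] by simp
  finally show ?thesis
    by (simp add: add_increasing2)
qed

lemma poisson_real: "poisson (of_real k) t = k / (pi * (k\<^sup>2 + t\<^sup>2))"
  by (simp add: poisson_def norm_diff_Complex_0)

text \<open>The \<open>decay\<close> demanded by \<open>hardy_one\<close> is derived here, from
  boundedness off the axis combined with damping.\<close>

locale hardy_half_plane =
  fixes g :: "complex \<Rightarrow> complex" and gs :: "real \<Rightarrow> complex" and M p :: real
  assumes M_nonneg: "0 \<le> M" and p1: "1 \<le> p" and p2: "p \<le> 2"
    and hol: "g holomorphic_on {z. 0 < Re z}"
    and M: "\<And>u. 0 < u \<Longrightarrow> (\<integral>\<^sup>+ t. norm (g (Complex u t)) powr p \<partial>lborel) \<le> ennreal M"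
    and gs_measurable [measurable]: "gs \<in> borel_measurable borel"
    and lim: "AE t in lborel. (\<lambda>n. g (Complex (inverse (Suc n)) t)) \<longlonglongrightarrow> gs t"
begin

lemma line_continuous:
  assumes "0 < u"
  shows "continuous_on UNIV (\<lambda>t. g (Complex u t))"
  by (rule continuous_on_compose2[OF holomorphic_on_imp_continuous_on[OF hol]])
    (use assms in \<open>auto intro!: continuous_intros\<close>)

lemma line_measurable: "0 < u \<Longrightarrow> (\<lambda>t. g (Complex u t)) \<in> borel_measurable borel"
  by (rule borel_measurable_continuous_onI[OF line_continuous])

text \<open>From \<open>h \<le> 1 + h powr p\<close>: the constant contributes the length of the
  segment, the power at most \<open>M\<close>, wherever the segment starts.\<close>

lemma integral_segment_le:
  assumes u: "0 < u" and s: "0 \<le> s"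
  shows "integral {0..s} (\<lambda>\<tau>. cmod (g (Complex u (y + \<tau>)))) \<le> s + M"
proof -
  define h where "h \<tau> = cmod (g (Complex u (y + \<tau>)))" for \<tau>
  have [measurable]: "(\<lambda>t. g (Complex u t)) \<in> borel_measurable borel"
    by (rule line_measurable[OF u])
  have hc: "continuous_on {0..s} h"
    unfolding h_def by (intro continuous_intros continuous_on_compose2[OF line_continuous[OF u]]) auto
  have hi: "set_integrable lborel {0..s} h"
    by (rule borel_integrable_atLeastAtMost'[OF hc])
  have "ennreal (integral {0..s} h) = ennreal (LINT \<tau>|lborel. indicator {0..s} \<tau> *\<^sub>R h \<tau>)"
    using set_borel_integral_eq_integral(2)[OF hi] by (simp add: set_lebesgue_integral_def)
  also have "\<dots> = (\<integral>\<^sup>+ \<tau>. indicator {0..s} \<tau> *\<^sub>R h \<tau> \<partial>lborel)"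
    using hi by (intro nn_integral_eq_integral[symmetric])
      (auto simp: set_integrable_def h_def)
  also have "\<dots> \<le> (\<integral>\<^sup>+ \<tau>. indicator {0..s} \<tau> + ennreal (h \<tau> powr p) \<partial>lborel)"
  proof (rule nn_integral_mono)
    fix \<tau>
    have "h \<tau> \<le> 1 + h \<tau> powr p"
    proof (cases "h \<tau> \<le> 1")
      case False
      then have "h \<tau> powr 1 \<le> h \<tau> powr p"
        using p1 by (intro powr_mono) auto
      then show ?thesis
        using False by simp
    qed (simp add: add_increasing2)
    then show "ennreal (indicator {0..s} \<tau> *\<^sub>R h \<tau>) \<le> indicator {0..s} \<tau> + ennreal (h \<tau> powr p)"
      by (auto simp: indicator_def ennreal_leI simp flip: ennreal_1 ennreal_plus)
  qed
  also have "\<dots> = (\<integral>\<^sup>+ \<tau>. indicator {0..s} \<tau> \<partial>lborel) + (\<integral>\<^sup>+ \<tau>. ennreal (h \<tau> powr p) \<partial>lborel)"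
    by (rule nn_integral_add) (auto simp: h_def)
  also have "(\<integral>\<^sup>+ \<tau>. ennreal (h \<tau> powr p) \<partial>lborel) = (\<integral>\<^sup>+ t. norm (g (Complex u t)) powr p \<partial>lborel)"
    unfolding h_def
    by (subst nn_integral_real_affine[where c = 1 and t = y and f = "\<lambda>t. ennreal (norm (g (Complex u t)) powr p)"])
      auto
  also have "\<dots> \<le> ennreal M"
    by (rule M[OF u])
  also have "(\<integral>\<^sup>+ \<tau>. indicator {0..s} \<tau> \<partial>lborel) = ennreal s"
    using s by simp
  finally have "ennreal (integral {0..s} h) \<le> ennreal s + ennreal M"
    by (simp add: add_left_mono)
  also have "\<dots> = ennreal (s + M)"
    using s M_nonneg by simp
  finally have "integral {0..s} h \<le> s + M"
    using s M_nonneg by (subst (asm) ennreal_le_iff) auto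
  then show ?thesis
    by (simp only: h_def[abs_def])
qed

text \<open>
  If \<open>\<Gamma>\<close> is a primitive of \<open>g\<close> then \<open>\<Gamma> (z + \<i> s) - \<Gamma> z\<close> is a vertical integral, which is bounded on
  the whole half plane.  By Cauchy's inequality its derivative \<open>g (z + \<i> s) - g z\<close> is bounded away
  from the boundary, and averaging over \<open>s\<close> bounds \<open>g z\<close> itself.
\<close>

lemma bounded_away_from_axis:
  assumes e: "0 < e"
  obtains B where "\<And>z. e \<le> Re z \<Longrightarrow> cmod (g z) \<le> B"
proof -
  let ?S = "{z. 0 < Re z}"
  obtain \<Gamma> where "\<And>z. z \<in> ?S \<Longrightarrow> (\<Gamma> has_field_derivative g z) (at z within ?S)"
    using holomorphic_convex_primitive'[OF convex_halfspace_Re_gt open_halfspace_Re_gt hol] by blast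
  then have \<Gamma>: "(\<Gamma> has_field_derivative g z) (at z)" if "0 < Re z" for z
    using that by (simp add: at_within_open[OF _ open_halfspace_Re_gt])
  define D where "D s z = \<Gamma> (z + \<i> * of_real s) - \<Gamma> z" for s :: real and z
  have D_le: "cmod (D s z) \<le> s + M" if "0 < Re z" "0 \<le> s" for s z
  proof -
    have eq: "z + \<i> * of_real \<tau> = Complex (Re z) (Im z + \<tau>)" for \<tau>
      by (simp add: complex_eq_iff)
    have "((\<lambda>\<tau>. \<i> * g (z + \<i> * of_real \<tau>)) has_integral (\<Gamma> (z + \<i> * of_real s) - \<Gamma> (z + \<i> * of_real 0))) {0..s}"
    proof (rule fundamental_theorem_of_calculus[OF \<open>0 \<le> s\<close>])
      fix \<tau>
      have "((\<lambda>\<tau>. z + \<i> * of_real \<tau>) has_vector_derivative \<i>) (at \<tau> within {0..s})"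
        by (auto intro!: derivative_eq_intros)
      then show "((\<lambda>\<tau>. \<Gamma> (z + \<i> * of_real \<tau>)) has_vector_derivative \<i> * g (z + \<i> * of_real \<tau>)) (at \<tau> within {0..s})"
        using field_vector_diff_chain_within[of "\<lambda>\<tau>. z + \<i> * of_real \<tau>" \<i> \<tau> "{0..s}" \<Gamma> "g (z + \<i> * of_real \<tau>)"]
          \<Gamma>[of "z + \<i> * of_real \<tau>"] that(1)
        by (simp add: o_def has_field_derivative_at_within)
    qed
    then have hi: "((\<lambda>\<tau>. \<i> * g (Complex (Re z) (Im z + \<tau>))) has_integral D s z) {0..s}"
      unfolding eq[symmetric] D_def by simp
    then have i: "D s z = integral {0..s} (\<lambda>\<tau>. \<i> * g (Complex (Re z) (Im z + \<tau>)))"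
      and int: "(\<lambda>\<tau>. \<i> * g (Complex (Re z) (Im z + \<tau>))) integrable_on {0..s}"
      by (rule integral_unique[symmetric], rule has_integral_integrable)
    have "cmod (D s z) \<le> integral {0..s} (\<lambda>\<tau>. cmod (g (Complex (Re z) (Im z + \<tau>))))"
      unfolding i
      by (rule integral_norm_bound_integral[OF int])
        (auto simp: norm_mult intro!: integrable_continuous_real continuous_intros
          continuous_on_compose2[OF line_continuous[OF that(1)]])
    also have "\<dots> \<le> s + M"
      by (rule integral_segment_le[OF that])
    finally show ?thesis .
  qed
  have osc: "cmod (g (z + \<i> * of_real s) - g z) \<le> (1 + M) / (e / 2)"
    if z: "e \<le> Re z" and s: "0 \<le> s" "s \<le> 1" for z s
  proof -
    have D': "(D s has_field_derivative (g (w + \<i> * of_real s) - g w)) (at w)" if "0 < Re w" for w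
    proof -
      have "((\<lambda>w. w + \<i> * of_real s) has_field_derivative 1) (at w)"
        by (auto intro!: derivative_eq_intros)
      then have "((\<lambda>w. \<Gamma> (w + \<i> * of_real s)) has_field_derivative g (w + \<i> * of_real s) * 1) (at w)"
        using \<Gamma>[of "w + \<i> * of_real s"] that by (intro DERIV_chain2) auto
      then show ?thesis
        unfolding D_def using \<Gamma>[OF that] by (auto intro!: derivative_eq_intros)
    qed
    have sub: "cball z (e / 2) \<subseteq> ?S"
    proof
      fix w
      assume "w \<in> cball z (e / 2)"
      then have "cmod (z - w) \<le> e / 2"
        by (simp add: dist_norm)
      then have "Re (z - w) \<le> e / 2"
        using complex_Re_le_cmod order_trans by blast
      then show "w \<in> ?S"
        using z e by simp
    qed
    have holD: "D s holomorphic_on ?S"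
      using D' by (auto simp: holomorphic_on_def field_differentiable_def intro: has_field_derivative_at_within)
    \<comment> \<open>The radius \<open>e / 2\<close> keeps the closed disc inside the half plane,
      where \<open>D s\<close> is bounded by \<open>1 + M\<close>.\<close>
    have "cmod ((deriv ^^ 1) (D s) z) \<le> fact 1 * (1 + M) / (e / 2) ^ 1"
    proof (rule Cauchy_inequality)
      show "D s holomorphic_on ball z (e / 2)"
        using holD sub ball_subset_cball by (meson holomorphic_on_subset)
      show "continuous_on (cball z (e / 2)) (D s)"
        using holD sub by (meson holomorphic_on_imp_continuous_on holomorphic_on_subset)
      show "cmod (D s w) \<le> 1 + M" if "cmod (z - w) = e / 2" for w
      proof -
        have "w \<in> ?S"
          using sub that by (auto simp: dist_norm subset_eq)
        then show ?thesis
          using D_le[of w s] s by simp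
      qed
    qed (use e in simp)
    moreover have "deriv (D s) z = g (z + \<i> * of_real s) - g z"
      using D'[of z] z e by (intro DERIV_imp_deriv) auto
    ultimately show ?thesis
      by simp
  qed
  have "cmod (g z) \<le> 1 + M + (1 + M) / (e / 2)" if z: "e \<le> Re z" for z
  proof -
    have z0: "0 < Re z"
      using z e by simp
    let ?h = "\<lambda>\<tau>. cmod (g (Complex (Re z) (Im z + \<tau>)))"
    have h: "?h integrable_on {0..1}"
      by (intro integrable_continuous_real continuous_intros
          continuous_on_compose2[OF line_continuous[OF z0]]) auto
    have "integral {0..1::real} (\<lambda>_. cmod (g z) - (1 + M) / (e / 2)) \<le> integral {0..1} ?h"
    proof (rule integral_le[OF _ h])
      fix \<tau> :: real
      assume \<tau>: "\<tau> \<in> {0..1}"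
      have eq: "z + \<i> * of_real \<tau> = Complex (Re z) (Im z + \<tau>)"
        by (simp add: complex_eq_iff)
      have "cmod (g z) - cmod (g (z + \<i> * of_real \<tau>)) \<le> cmod (g z - g (z + \<i> * of_real \<tau>))"
        by (rule norm_triangle_ineq2)
      also have "\<dots> \<le> (1 + M) / (e / 2)"
        using osc[OF z, of \<tau>] \<tau> by (simp add: norm_minus_commute)
      finally show "cmod (g z) - (1 + M) / (e / 2) \<le> ?h \<tau>"
        by (simp add: eq)
    qed (intro integrable_continuous_real continuous_on_const)
    also have "\<dots> \<le> 1 + M"
      by (rule integral_segment_le[OF z0]) simp
    finally show ?thesis
      by simp
  qed
  then show ?thesis
    by (rule that)
qed

lemma boundary_nn_integral: "(\<integral>\<^sup>+ t. norm (gs t) powr p \<partial>lborel) \<le> ennreal M"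
proof (rule nn_integral_le_of_AE_tendsto[OF _ M])
  have [measurable]: "(\<lambda>t. g (Complex (inverse (Suc n)) t)) \<in> borel_measurable borel" for n
    by (rule line_measurable) simp
  show "(\<lambda>t. ennreal (norm (g (Complex (inverse (Suc n)) t)) powr p)) \<in> borel_measurable lborel" for n
    by measurable
  show "AE t in lborel. (\<lambda>n. ennreal (norm (g (Complex (inverse (Suc n)) t)) powr p)) \<longlonglongrightarrow> ennreal (norm (gs t) powr p)"
    using lim by eventually_elim (use p1 in \<open>auto intro!: tendsto_ennrealI tendsto_powr' tendsto_norm\<close>)
qed simp

text \<open>The factor decays like \<open>1 / cmod z\<close>, which with
  \<open>bounded_away_from_axis\<close> gives the required decay. On vertical lines its squared
  modulus is at most \<open>pi * k\<close> times the Poisson kernel at \<open>k\<close>, with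
  integral \<open>pi * k\<close>; \<open>mult_le_powr_add_square\<close> then produces the bound
  \<open>M + pi * k\<close>.\<close>

lemma damped_hardy_one:
  assumes k: "1 \<le> k"
  shows "hardy_one (\<lambda>z. g z * (k / (k + z))) (\<lambda>t. gs t * (k / (k + Complex 0 t))) (M + pi * k)"
proof
  have k0: "0 < k"
    using k by simp
  have ne: "of_real k + z \<noteq> 0" if "0 \<le> Re z" for z
    using that k by (auto simp: complex_eq_iff)
  show "0 \<le> M + pi * k"
    using M_nonneg k by simp
  show "(\<lambda>z. g z * (k / (k + z))) holomorphic_on {z. 0 < Re z}"
    using ne by (intro holomorphic_intros hol) (auto simp: less_imp_le)
  show "(\<lambda>t. gs t * (k / (k + Complex 0 t))) \<in> borel_measurable borel"
    by measurable
  show "AE t in lborel. (\<lambda>n. g (Complex (inverse (Suc n)) t) * (k / (k + Complex (inverse (Suc n)) t)))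
      \<longlonglongrightarrow> gs t * (k / (k + Complex 0 t))"
    using lim
  proof eventually_elim
    fix t
    assume 1: "(\<lambda>n. g (Complex (inverse (Suc n)) t)) \<longlonglongrightarrow> gs t"
    have 2: "(\<lambda>n. Complex (inverse (Suc n)) t) \<longlonglongrightarrow> Complex 0 t"
      by (intro tendsto_Complex LIMSEQ_inverse_real_of_nat tendsto_const)
    show "(\<lambda>n. g (Complex (inverse (Suc n)) t) * (k / (k + Complex (inverse (Suc n)) t)))
        \<longlonglongrightarrow> gs t * (k / (k + Complex 0 t))"
      by (intro tendsto_mult tendsto_divide tendsto_add tendsto_const 1 2 ne) simp
  qed
  show "\<exists>C. \<forall>z::complex. e \<le> Re z \<longrightarrow> cmod (g z * (k / (k + z))) * (1 + cmod z) \<le> C" if "0 < e" for e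
  proof -
    obtain B where B: "\<And>z. e \<le> Re z \<Longrightarrow> cmod (g z) \<le> B"
      using bounded_away_from_axis[OF \<open>0 < e\<close>] by blast
    have "cmod (g z * (k / (k + z))) * (1 + cmod z) \<le> B * (2 * k)" if z: "e \<le> Re z" for z :: complex
    proof -
      have "(cmod z)\<^sup>2 \<le> (cmod (of_real k + z))\<^sup>2"
        unfolding cmod_power2 using z k0 \<open>0 < e\<close> by (simp add: power_mono)
      then have 1: "cmod z \<le> cmod (of_real k + z)"
        by (rule power2_le_imp_le) simp
      \<comment> \<open>Here \<open>1 \<le> k\<close> enters: together with \<open>1\<close> it
        bounds \<open>(1 + cmod z) / cmod (of_real k + z)\<close> by \<open>2\<close>.\<close>
      have 2: "1 \<le> cmod (of_real k + z)"
        using complex_Re_le_cmod[of "of_real k + z"] z k \<open>0 < e\<close> by simp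
      have "cmod (k / (k + z)) * (1 + cmod z) = k * ((1 + cmod z) / cmod (of_real k + z))"
        using k0 by (simp add: norm_divide)
      also have "\<dots> \<le> k * 2"
        using 1 2 k0 by (intro mult_left_mono) (auto simp: divide_le_eq)
      finally have 3: "cmod (k / (k + z)) * (1 + cmod z) \<le> k * 2" .
      have "cmod (g z) * (cmod (k / (k + z)) * (1 + cmod z)) \<le> B * (k * 2)"
        by (rule mult_mono[OF B[OF z] 3 order_trans[OF norm_ge_zero B[OF z]]]) simp
      then show ?thesis
        by (simp only: norm_mult mult.assoc mult.commute[of k 2])
    qed
    then show ?thesis
      by (intro exI allI impI)
  qed
  show "(\<integral>\<^sup>+ t. norm (g (Complex u t) * (k / (k + Complex u t))) \<partial>lborel) \<le> ennreal (M + pi * k)"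
    if u: "0 < u" for u
  proof -
    have [measurable]: "(\<lambda>t. g (Complex u t)) \<in> borel_measurable borel"
      by (rule line_measurable[OF u])
    have "(\<integral>\<^sup>+ t. norm (g (Complex u t) * (k / (k + Complex u t))) \<partial>lborel)
        \<le> (\<integral>\<^sup>+ t. ennreal (norm (g (Complex u t)) powr p) + ennreal (pi * k) * ennreal (poisson (of_real k) t) \<partial>lborel)"
    proof (rule nn_integral_mono)
      fix t
      define b where "b = norm (k / (k + Complex u t))"
      have "k \<le> cmod (of_real k + Complex u t)"
        using complex_Re_le_cmod[of "of_real k + Complex u t"] u by simp
      then have b1: "0 \<le> b" "b \<le> 1"
        using k0 by (auto simp: b_def norm_divide divide_le_eq)
      have "b\<^sup>2 = k\<^sup>2 / ((k + u)\<^sup>2 + t\<^sup>2)"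
        using k0 by (simp add: b_def norm_divide power_divide cmod_power2)
      also have "\<dots> \<le> k\<^sup>2 / (k\<^sup>2 + t\<^sup>2)"
        using k0 u by (intro divide_left_mono add_right_mono power_mono mult_pos_pos add_pos_nonneg) auto
      also have "\<dots> = pi * k * poisson (of_real k) t"
        by (simp add: poisson_real power2_eq_square)
      finally have "norm (g (Complex u t)) * b \<le> norm (g (Complex u t)) powr p + pi * k * poisson (of_real k) t"
        using mult_le_powr_add_square[OF p1 p2 norm_ge_zero b1, of "g (Complex u t)"] by simp
      then have "norm (g (Complex u t) * (k / (k + Complex u t)))
          \<le> norm (g (Complex u t)) powr p + pi * k * poisson (of_real k) t"
        unfolding norm_mult b_def[symmetric] .
      then have "ennreal (norm (g (Complex u t) * (k / (k + Complex u t))))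
          \<le> ennreal (norm (g (Complex u t)) powr p + pi * k * poisson (of_real k) t)"
        by (rule ennreal_leI)
      also have "\<dots> = ennreal (norm (g (Complex u t)) powr p) + ennreal (pi * k) * ennreal (poisson (of_real k) t)"
        using k0 by (simp add: ennreal_mult poisson_nonneg)
      finally show "ennreal (norm (g (Complex u t) * (k / (k + Complex u t))))
          \<le> ennreal (norm (g (Complex u t)) powr p) + ennreal (pi * k) * ennreal (poisson (of_real k) t)" .
    qed
    also have "\<dots> = (\<integral>\<^sup>+ t. norm (g (Complex u t)) powr p \<partial>lborel)
        + ennreal (pi * k) * (\<integral>\<^sup>+ t. poisson (of_real k) t \<partial>lborel)"
      by (simp add: nn_integral_add nn_integral_cmult)
    also have "(\<integral>\<^sup>+ t. poisson (of_real k) t \<partial>lborel) = ennreal 1"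
      using has_bochner_integral_poisson[of "of_real k"] k0
      by (subst nn_integral_eq_integral) (auto simp: has_bochner_integral_iff poisson_nonneg)
    also have "(\<integral>\<^sup>+ t. norm (g (Complex u t)) powr p \<partial>lborel) + ennreal (pi * k) * ennreal 1 \<le> ennreal M + ennreal (pi * k)"
      using M[OF u] by (simp add: add_right_mono)
    also have "\<dots> = ennreal (M + pi * k)"
      using M_nonneg k0 by simp
    finally show ?thesis .
  qed
qed

text \<open>Damp with \<open>k = Suc n\<close>, apply the formula for exponent 1, and let
  \<open>n\<close> grow: the factors tend to \<open>1\<close> and are bounded by \<open>1\<close> on
  the axis, so the undamped integrand dominates.\<close>

lemma cauchy_integral:
  assumes z: "0 < Re z"
  shows "has_bochner_integral lborel (\<lambda>t. gs t / (2 * pi * (z - Complex 0 t))) (g z)"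
proof -
  define F where "F t = gs t / (2 * pi * (z - Complex 0 t))" for t
  define c where "c n t = of_real (Suc n) / (of_real (Suc n) + t)" for n and t :: complex
  have int: "integrable lborel F"
  proof (rule Bochner_Integration.integrable_bound)
    show "F \<in> borel_measurable lborel"
      unfolding F_def by measurable
    have "(\<integral>\<^sup>+ t. norm (norm (gs t) powr p) \<partial>lborel) < \<infinity>"
      using boundary_nn_integral by (auto intro: le_less_trans)
    then have "integrable lborel (\<lambda>t. norm (gs t) powr p)"
      by (simp add: integrable_iff_bounded)
    then show "integrable lborel (\<lambda>t. 1 / (2 * pi * Re z) * (norm (gs t) powr p + pi * Re z * poisson z t))"
      using has_bochner_integral_poisson[OF z] by (simp add: has_bochner_integral_iff)
    show "AE t in lborel. norm (F t) \<le> norm (1 / (2 * pi * Re z) * (norm (gs t) powr p + pi * Re z * poisson z t))"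
    proof (rule AE_I2)
      fix t
      \<comment> \<open>The Cauchy kernel scaled to be at most \<open>1\<close>; its square is a
        multiple of the Poisson kernel, hence integrable.\<close>
      define b where "b = Re z / cmod (z - Complex 0 t)"
      have "Re z \<le> cmod (z - Complex 0 t)"
        using complex_Re_le_cmod[of "z - Complex 0 t"] by simp
      then have b: "0 \<le> b" "b \<le> 1"
        using z by (auto simp: b_def divide_le_eq)
      have "b\<^sup>2 = pi * Re z * poisson z t"
        by (simp add: b_def poisson_def power_divide power2_eq_square)
      then have "norm (gs t) * b \<le> norm (gs t) powr p + pi * Re z * poisson z t"
        using mult_le_powr_add_square[OF p1 p2 norm_ge_zero b, of "gs t"] by simp
      then have "1 / (2 * pi * Re z) * (norm (gs t) * b) \<le> 1 / (2 * pi * Re z) * (norm (gs t) powr p + pi * Re z * poisson z t)"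
        using z by (intro mult_left_mono) auto
      moreover have "norm (F t) = 1 / (2 * pi * Re z) * (norm (gs t) * b)"
        using z by (simp add: F_def b_def norm_divide norm_mult)
      ultimately show "norm (F t) \<le> norm (1 / (2 * pi * Re z) * (norm (gs t) powr p + pi * Re z * poisson z t))"
        unfolding real_norm_def by linarith
    qed
  qed
  have c_lim: "(\<lambda>n. c n w) \<longlonglongrightarrow> 1" for w :: complex
  proof -
    have "(\<lambda>n. 1 + w * of_real (inverse (Suc n))) \<longlonglongrightarrow> 1 + w * of_real 0"
      by (intro tendsto_intros LIMSEQ_inverse_real_of_nat)
    then have "(\<lambda>n. inverse (1 + w * of_real (inverse (Suc n)))) \<longlonglongrightarrow> inverse (1 + w * of_real 0)"
      by (rule tendsto_inverse) simp
    moreover have r: "inverse (1 + w * of_real (inverse r)) = of_real r / (of_real r + w)"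
      if "0 < r" for r :: real
    proof -
      have "1 + w * of_real (inverse r) = (of_real r + w) / of_real r"
        unfolding of_real_inverse divide_inverse[symmetric] using that by (simp add: add_divide_distrib)
      then show ?thesis
        by (simp only: inverse_divide)
    qed
    have "inverse (1 + w * of_real (inverse (Suc n))) = c n w" for n
      unfolding c_def by (rule r) simp
    ultimately show ?thesis
      by simp
  qed
  have c_le: "cmod (c n (Complex 0 t)) \<le> 1" for n t
  proof -
    have "cmod (of_real r / (of_real r + Complex 0 t)) \<le> 1" if "0 < r" for r
      using complex_Re_le_cmod[of "of_real r + Complex 0 t"] that
      by (simp add: norm_divide divide_le_eq)
    then show ?thesis
      unfolding c_def by (simp only: of_nat_0_less_iff zero_less_Suc)
  qed
  have eq: "g z * c n z = (LINT t|lborel. F t * c n (Complex 0 t))" for n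
  proof -
    \<comment> \<open>In this block \<open>cauchy_integral\<close> denotes the formula of
      \<open>hardy_one\<close> for the damped function.\<close>
    interpret hardy_one "\<lambda>z. g z * c n z" "\<lambda>t. gs t * c n (Complex 0 t)" "M + pi * Suc n"
      unfolding c_def by (rule damped_hardy_one) simp
    show ?thesis
      using cauchy_integral[OF z] by (simp add: has_bochner_integral_iff F_def)
  qed
  have "(\<lambda>n. LINT t|lborel. F t * c n (Complex 0 t)) \<longlonglongrightarrow> (LINT t|lborel. F t)"
  proof (rule integral_dominated_convergence[OF _ _ integrable_norm[OF int]])
    show "AE t in lborel. (\<lambda>n. F t * c n (Complex 0 t)) \<longlonglongrightarrow> F t"
    proof (rule AE_I2)
      show "(\<lambda>n. F t * c n (Complex 0 t)) \<longlonglongrightarrow> F t" for t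
        using tendsto_mult[OF tendsto_const c_lim, of "F t" "Complex 0 t"] by simp
    qed
    show "AE t in lborel. norm (F t * c n (Complex 0 t)) \<le> norm (F t)" for n
      using c_le by (auto simp: norm_mult mult_left_le)
    show "(\<lambda>t. F t * c n (Complex 0 t)) \<in> borel_measurable lborel" for n
      unfolding F_def c_def by measurable
    show "F \<in> borel_measurable lborel"
      using int by measurable
  qed
  then have "(\<lambda>n. g z * c n z) \<longlonglongrightarrow> (LINT t|lborel. F t)"
    by (simp only: eq)
  moreover have "(\<lambda>n. g z * c n z) \<longlonglongrightarrow> g z * 1"
    by (intro tendsto_mult tendsto_const c_lim)
  ultimately have "(LINT t|lborel. F t) = g z * 1"
    by (rule LIMSEQ_unique)
  then show ?thesis
    using int by (simp add: has_bochner_integral_iff F_def[abs_def])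
qed

end

section \<open>Slice monogenic functions\<close>

text \<open>The real part is a coordinate of \<open>a\<close>; the imaginary part is then forced by
  the demand that left multiplication by \<open>I\<close> become multiplication by
  \<open>\<i>\<close>.\<close>

definition complex_component :: "'n::{finite,linorder} clifford \<Rightarrow> 'n clifford \<Rightarrow> 'n clifford \<Rightarrow> complex" where
  "complex_component I c a = Complex (inner a c) (- inner (I * a) c)"

lemma linear_complex_component: "linear (complex_component I c)"
  by (rule linearI) (simp_all add: complex_component_def complex_eq_iff distrib_left inner_left_distrib)

lemma bounded_linear_clifford_mult: "bounded_linear (\<lambda>a. c * a)"
  for c :: "'n::{finite,linorder} clifford"
  unfolding linear_conv_bounded_linear[symmetric] by (rule linearI) (simp_all add: distrib_left)

lemma unit_sphere_mult_cancel: "I \<in> unit_sphere \<Longrightarrow> I * (I * a) = - a"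
  by (simp add: unit_sphere_square flip: mult.assoc)

lemma complex_component_mult:
  "I \<in> unit_sphere \<Longrightarrow> complex_component I c (I * a) = \<i> * complex_component I c a"
  by (simp add: complex_component_def complex_eq_iff unit_sphere_mult_cancel)

lemma bounded_linear_slice_point: "bounded_linear (\<lambda>z. slice_point I (Re z) (Im z))"
  unfolding linear_conv_bounded_linear[symmetric]
  by (rule linearI) (simp_all add: slice_point_def of_real_def algebra_simps)

lemma linear_slice_point_mult:
  fixes L :: "'n::{finite,linorder} clifford \<Rightarrow> complex"
  assumes "linear L" "\<And>a. L (I * a) = \<i> * L a"
  shows "L (slice_point I (Re w) (Im w) * a) = w * L a"
proof -
  have "slice_point I (Re w) (Im w) * a = Re w *\<^sub>R a + Im w *\<^sub>R (I * a)"
    by (simp add: slice_point_def of_real_def distrib_right)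
  then have "L (slice_point I (Re w) (Im w) * a) = Re w *\<^sub>R L a + Im w *\<^sub>R (\<i> * L a)"
    using assms by (simp add: linear_add linear_scale)
  also have "\<dots> = w * L a"
    by (simp add: complex_eq_iff)
  finally show ?thesis .
qed

lemma slice_point_in_half_space: "I \<in> unit_sphere \<Longrightarrow> 0 < u \<Longrightarrow> slice_point I u v \<in> half_space"
  unfolding half_space_def by blast

text \<open>Slice monogenicity says that the differential along the plane of \<open>I\<close>
  satisfies \<open>D' \<i> = I * D' 1\<close>; after \<open>L\<close> it becomes multiplication by
  the complex number \<open>L (D' 1)\<close>.\<close>

lemma holomorphic_slice_component:
  fixes f :: "'n::{finite,linorder} clifford \<Rightarrow> 'n clifford"
  assumes f: "f \<in> slice_monogenic half_space" and I: "I \<in> unit_sphere"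
    and L: "linear L" "\<And>a. L (I * a) = \<i> * L a"
  shows "(\<lambda>z. L (f (slice_point I (Re z) (Im z)))) holomorphic_on {z. 0 < Re z}"
  unfolding holomorphic_on_def
proof
  fix z :: complex
  assume "z \<in> {z. 0 < Re z}"
  then have z: "0 < Re z"
    by simp
  let ?S = "{z. 0 < Re z}" and ?\<phi> = "\<lambda>z. slice_point I (Re z) (Im z)"
  have \<phi>_half: "?\<phi> w \<in> half_space" if "0 < Re w" for w
    using I that by (rule slice_point_in_half_space)
  obtain D where D: "(f has_derivative D) (at (?\<phi> z) within half_space)"
    using f \<phi>_half[OF z] by (auto simp: slice_monogenic_def differentiable_on_def differentiable_def)
  \<comment> \<open>\<open>half_space\<close> need not be open in the algebra, so \<open>f\<close>
    is differentiable only within it; the right half plane is open in the complex plane, so the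
    composition is differentiable outright.\<close>
  have "((\<lambda>w. f (?\<phi> w)) has_derivative (\<lambda>w. D (?\<phi> w))) (at z within ?S)"
    by (rule has_derivative_in_compose[OF bounded_linear.has_derivative[OF bounded_linear_slice_point has_derivative_ident]])
      (rule has_derivative_subset[OF D], use \<phi>_half in auto)
  then have F: "((\<lambda>w. f (?\<phi> w)) has_derivative (\<lambda>w. D (?\<phi> w))) (at z)"
    using z by (simp add: at_within_open[OF _ open_halfspace_Re_gt])
  define D' where "D' w = D (?\<phi> w)" for w
  have linD': "linear D'"
    using has_derivative_linear[OF F] by (simp add: D'_def[abs_def])
  have "((\<lambda>s. Complex s (Im z)) has_derivative of_real) (at (Re z))"
    unfolding Complex_eq by (auto intro!: derivative_eq_intros)
  then have "((\<lambda>s. f (?\<phi> (Complex s (Im z)))) has_derivative (\<lambda>s. D' (of_real s))) (at (Re z))"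
    unfolding D'_def by (rule has_derivative_compose) (use F in simp)
  then have "((\<lambda>s. f (slice_point I s (Im z))) has_vector_derivative D' 1) (at (Re z))"
    unfolding has_vector_derivative_def using linear_scale[OF linD', of _ 1] by (simp add: of_real_def)
  then have d1: "vector_derivative (\<lambda>s. f (slice_point I s (Im z))) (at (Re z)) = D' 1"
    by (rule vector_derivative_at)
  have "((\<lambda>t. Complex (Re z) t) has_derivative (\<lambda>t. t *\<^sub>R \<i>)) (at (Im z))"
    unfolding Complex_eq scaleR_conv_of_real by (auto intro!: derivative_eq_intros)
  then have "((\<lambda>t. f (?\<phi> (Complex (Re z) t))) has_derivative (\<lambda>t. D' (t *\<^sub>R \<i>))) (at (Im z))"
    unfolding D'_def by (rule has_derivative_compose) (use F in simp)
  then have "((\<lambda>t. f (slice_point I (Re z) t)) has_vector_derivative D' \<i>) (at (Im z))"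
    unfolding has_vector_derivative_def using linear_scale[OF linD', of _ \<i>] by simp
  then have d2: "vector_derivative (\<lambda>t. f (slice_point I (Re z) t)) (at (Im z)) = D' \<i>"
    by (rule vector_derivative_at)
  have "(1 / 2) *\<^sub>R (D' 1 + I * D' \<i>) = 0"
    using f I \<phi>_half[OF z] unfolding d1[symmetric] d2[symmetric] slice_monogenic_def by blast
  then have "D' 1 = - (I * D' \<i>)"
    by (simp add: add_eq_0_iff2)
  then have CR: "I * D' 1 = D' \<i>"
    using unit_sphere_mult_cancel[OF I, of "D' \<i>"] by simp
  have "L (D' h) = L (D' 1) * h" for h
  proof -
    have "D' h = D' (Re h *\<^sub>R 1 + Im h *\<^sub>R \<i>)"
      by (rule arg_cong[where f = D']) (simp add: complex_eq_iff)
    also have "\<dots> = Re h *\<^sub>R D' 1 + Im h *\<^sub>R (I * D' 1)"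
      unfolding CR using linD' by (simp add: linear_add linear_scale)
    also have "\<dots> = slice_point I (Re h) (Im h) * D' 1"
      by (simp add: slice_point_def of_real_def distrib_right)
    finally show ?thesis
      using linear_slice_point_mult[OF L, of h "D' 1"] by (simp only: mult.commute)
  qed
  then have "(\<lambda>h. L (D' h)) = (*) (L (D' 1))"
    by (rule ext)
  moreover have "((\<lambda>w. L (f (?\<phi> w))) has_derivative (\<lambda>h. L (D' h))) (at z)"
    unfolding D'_def
    by (rule bounded_linear.has_derivative[OF _ F]) (use L(1) in \<open>simp add: linear_conv_bounded_linear\<close>)
  ultimately have "((\<lambda>w. L (f (?\<phi> w))) has_field_derivative L (D' 1)) (at z)"
    by (simp only: has_field_derivative_def)
  then show "(\<lambda>w. L (f (?\<phi> w))) field_differentiable (at z within ?S)"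
    using field_differentiable_def has_field_derivative_at_within by blast
qed

section \<open>Boundary limits and the Cauchy formula for components\<close>

text \<open>The horizontal ray lies in every approach region; aperture \<open>1\<close> is an
  arbitrary choice.\<close>

lemma nontangential_imp_radial_limit:
  assumes "has_nontangential_limit f I v l"
  shows "((\<lambda>s. f (slice_point I s v)) \<longlongrightarrow> l) (at_right 0)"
proof -
  have 1: "(f \<longlongrightarrow> l) (at (slice_point I 0 v) within approach_region I 1 v)"
    using assms by (simp add: has_nontangential_limit_def)
  have "((\<lambda>s. slice_point I s v) \<longlongrightarrow> slice_point I 0 v) (at_right 0)"
    unfolding slice_point_def of_real_def by (intro tendsto_intros)
  moreover have "\<forall>\<^sub>F s in at_right 0. slice_point I s v \<in> approach_region I 1 v \<and> slice_point I s v \<noteq> slice_point I 0 v"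
    unfolding eventually_at_filter
  proof (intro always_eventually allI impI conjI)
    fix s :: real
    assume "s \<in> {0<..}"
    then show "slice_point I s v \<in> approach_region I 1 v"
      unfolding approach_region_def
      by - (rule CollectI, rule exI[of _ s], rule exI[of _ v], simp)
  qed (simp add: slice_point_def)
  ultimately have "filterlim (\<lambda>s. slice_point I s v) (at (slice_point I 0 v) within approach_region I 1 v) (at_right 0)"
    by (simp only: filterlim_at)
  from filterlim_compose[OF 1 this] show ?thesis .
qed

text \<open>Uniqueness of limits along the ray makes the definite description in
  \<open>boundary_value\<close> meaningful.\<close>

lemma boundary_value_radial_limit:
  assumes "has_nontangential_limit f I v l"
  shows "((\<lambda>s. f (slice_point I s v)) \<longlongrightarrow> boundary_value f I v) (at_right 0)"
proof -
  have "boundary_value f I v = l"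
    unfolding boundary_value_def
  proof (rule the_equality, rule assms)
    show "l' = l" if "has_nontangential_limit f I v l'" for l'
      by (rule tendsto_unique[OF _ nontangential_imp_radial_limit[OF that] nontangential_imp_radial_limit[OF assms]]) simp
  qed
  then show ?thesis
    using nontangential_imp_radial_limit[OF assms] by simp
qed

text \<open>Completeness of Lebesgue measure; it supplies measurability of boundary values, which
  their definition does not show.\<close>

lemma measurable_lebesgue_AE_eq:
  fixes f g :: "real \<Rightarrow> 'a::topological_space"
  assumes f: "f \<in> borel_measurable lebesgue" and eq: "AE x in lebesgue. f x = g x"
  shows "g \<in> borel_measurable lebesgue"
proof (rule measurableI)
  fix A :: "'a set"
  assume "A \<in> sets borel"
  then have m: "f -` A \<inter> space lebesgue \<in> sets lebesgue"
    by (rule measurable_sets[OF f])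
  have ae: "AE x in lebesgue. x \<in> f -` A \<inter> space lebesgue \<longleftrightarrow> x \<in> g -` A \<inter> space lebesgue"
    using eq by eventually_elim auto
  show "g -` A \<inter> space lebesgue \<in> sets lebesgue"
    by (rule completion.in_sets_AE[OF ae m]) simp
qed simp

lemma has_bochner_integral_slice_component:
  fixes f :: "'n::{finite,linorder} clifford \<Rightarrow> 'n clifford"
  assumes p: "1 \<le> p" "p \<le> 2" and f: "f \<in> hardy_slice p" and I: "I \<in> unit_sphere"
    and L: "linear L" "\<And>a. L (I * a) = \<i> * L a" and z: "0 < Re z"
  shows "has_bochner_integral lebesgue (\<lambda>t. L (boundary_value f I t) / (2 * pi * (z - Complex 0 t)))
    (L (f (slice_point I (Re z) (Im z))))"
proof -
  define g where "g w = L (f (slice_point I (Re w) (Im w)))" for w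
  \<comment> \<open>A limit of continuous functions is Borel measurable whatever \<open>lim\<close>
    yields where there is no convergence; almost everywhere it equals
    \<open>L (boundary_value f I t)\<close>.\<close>
  define gs where "gs t = lim (\<lambda>n. g (Complex (inverse (Suc n)) t))" for t
  have f': "f \<in> slice_monogenic half_space"
    using f by (simp add: hardy_slice_def)
  have hol: "g holomorphic_on {z. 0 < Re z}"
    unfolding g_def by (rule holomorphic_slice_component[OF f' I L])
  have meas: "(\<lambda>t. g (Complex u t)) \<in> borel_measurable borel" if "0 < u" for u
    by (rule borel_measurable_continuous_onI)
      (rule continuous_on_compose2[OF holomorphic_on_imp_continuous_on[OF hol]],
        use that in \<open>auto intro!: continuous_intros\<close>)
  have bl: "bounded_linear L"
    using L(1) by (simp add: linear_conv_bounded_linear)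
  have AE_lim: "AE t in lebesgue. (\<lambda>n. g (Complex (inverse (Suc n)) t)) \<longlonglongrightarrow> L (boundary_value f I t)"
  proof -
    have "AE t in lebesgue. \<exists>l. has_nontangential_limit f I t l"
      using f I by (simp add: hardy_slice_def)
    then show ?thesis
    proof eventually_elim
      fix t
      assume "\<exists>l. has_nontangential_limit f I t l"
      then have "((\<lambda>s. f (slice_point I s t)) \<longlongrightarrow> boundary_value f I t) (at_right 0)"
        using boundary_value_radial_limit by blast
      then have "((\<lambda>s. L (f (slice_point I s t))) \<longlongrightarrow> L (boundary_value f I t)) (at_right 0)"
        by (rule bounded_linear.tendsto[OF bl])
      moreover have "filterlim (\<lambda>n. inverse (real (Suc n))) (at_right 0) sequentially"
        using LIMSEQ_inverse_real_of_nat by (auto simp: filterlim_at)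
      ultimately show "(\<lambda>n. g (Complex (inverse (Suc n)) t)) \<longlonglongrightarrow> L (boundary_value f I t)"
        unfolding g_def complex.sel by (rule filterlim_compose)
    qed
  qed
  have AE_gs: "AE t in lebesgue. gs t = L (boundary_value f I t)"
    using AE_lim by eventually_elim (simp add: gs_def limI)
  obtain B where B: "0 < B" "\<And>a. norm (L a) \<le> norm a * B"
    using bounded_linear.pos_bounded[OF bl] by blast
  define Q where "Q = (SUP u\<in>{0<..}. \<integral>\<^sup>+ v. ennreal (norm (f (slice_point I u v)) powr p) \<partial>lebesgue)"
  have "Q < \<infinity>"
    using f I by (simp add: hardy_slice_def Q_def)
  then obtain q where q: "0 \<le> q" "Q = ennreal q"
    by (cases Q) auto
  have bound: "(\<integral>\<^sup>+ t. norm (g (Complex u t)) powr p \<partial>lborel) \<le> ennreal (B powr p * q)" if "0 < u" for u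
  proof -
    have "(\<integral>\<^sup>+ t. norm (g (Complex u t)) powr p \<partial>lborel)
        \<le> (\<integral>\<^sup>+ t. ennreal (B powr p) * ennreal (norm (f (slice_point I u t)) powr p) \<partial>lebesgue)"
      unfolding nn_integral_completion
    proof (rule nn_integral_mono)
      fix t
      have "norm (g (Complex u t)) powr p \<le> (norm (f (slice_point I u t)) * B) powr p"
        unfolding g_def complex.sel using p by (intro powr_mono2 B) auto
      also have "\<dots> = B powr p * norm (f (slice_point I u t)) powr p"
        using B(1) by (simp add: powr_mult)
      finally show "ennreal (norm (g (Complex u t)) powr p)
          \<le> ennreal (B powr p) * ennreal (norm (f (slice_point I u t)) powr p)"
        by (simp add: ennreal_leI flip: ennreal_mult)
    qed
    also have "\<dots> = ennreal (B powr p) * (\<integral>\<^sup>+ t. ennreal (norm (f (slice_point I u t)) powr p) \<partial>lebesgue)"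
    proof (rule nn_integral_cmult)
      have "continuous_on half_space f"
        using f' by (simp add: slice_monogenic_def differentiable_imp_continuous_on)
      then have "continuous_on UNIV (\<lambda>t. f (slice_point I u t))"
        by (rule continuous_on_compose2)
          (use I that in \<open>auto simp: slice_point_def half_space_def intro!: continuous_intros\<close>)
      then have [measurable]: "(\<lambda>t. f (slice_point I u t)) \<in> borel_measurable borel"
        by (rule borel_measurable_continuous_onI)
      show "(\<lambda>t. ennreal (norm (f (slice_point I u t)) powr p)) \<in> borel_measurable lebesgue"
        by (rule measurable_completion) measurable
    qed
    also have "\<dots> \<le> ennreal (B powr p) * Q"
      unfolding Q_def using that by (intro mult_left_mono SUP_upper) auto
    also have "\<dots> = ennreal (B powr p * q)"
      using q by (simp add: ennreal_mult)
    finally show ?thesis .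
  qed
  interpret hardy_half_plane g gs "B powr p * q" p
  proof
    show "gs \<in> borel_measurable borel"
      unfolding gs_def by (rule borel_measurable_lim_metric) (rule meas, simp)
    show "AE t in lborel. (\<lambda>n. g (Complex (inverse (Suc n)) t)) \<longlonglongrightarrow> gs t"
      using AE_lim AE_gs unfolding AE_completion_iff by eventually_elim simp
  qed (use p q hol bound in auto)
  have hb: "has_bochner_integral lborel (\<lambda>t. gs t / (2 * pi * (z - Complex 0 t))) (g z)"
    by (rule cauchy_integral[OF z])
  have m: "(\<lambda>t. gs t / (2 * pi * (z - Complex 0 t))) \<in> borel_measurable lborel"
    using hb by (rule borel_measurable_has_bochner_integral)
  have hb': "has_bochner_integral lebesgue (\<lambda>t. gs t / (2 * pi * (z - Complex 0 t))) (g z)"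
    using hb unfolding has_bochner_integral_iff integrable_completion[OF m] integral_completion[OF m] .
  have AE_eq: "AE t in lebesgue. gs t / (2 * pi * (z - Complex 0 t))
      = L (boundary_value f I t) / (2 * pi * (z - Complex 0 t))"
    using AE_gs by eventually_elim simp
  have m': "(\<lambda>t. gs t / (2 * pi * (z - Complex 0 t))) \<in> borel_measurable lebesgue"
    using m by (rule measurable_completion)
  have "has_bochner_integral lebesgue (\<lambda>t. L (boundary_value f I t) / (2 * pi * (z - Complex 0 t))) (g z)"
    using has_bochner_integral_cong_AE[OF m' measurable_lebesgue_AE_eq[OF m' AE_eq] AE_eq] hb' by simp
  then show ?thesis
    by (simp add: g_def)
qed

section \<open>The Cauchy kernel on a slice and the passage to other slices\<close>

text \<open>The exponential integral, computed in the complex plane and carried over by the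
  embedding \<open>\<phi>\<close>: \<open>exp (x *\<^sub>R z) / z\<close> is a primitive that
  vanishes at minus infinity because \<open>u\<close> is positive. The result is the classical
  Cauchy kernel.\<close>

lemma half_plane_kernel_eq:
  fixes I :: "'n::{finite,linorder} clifford"
  assumes I: "I \<in> unit_sphere" and u: "0 < u"
  shows "half_plane_kernel I (slice_point I u v) 0 \<xi>
    = (let w = 1 / (2 * pi * (Complex u v - Complex 0 \<xi>)) in slice_point I (Re w) (Im w))"
proof -
  define z where "z = Complex u (v - \<xi>)"
  define \<phi> where "\<phi> w = slice_point I (Re w) (Im w)" for w
  have bl: "bounded_linear \<phi>"
    unfolding \<phi>_def by (rule bounded_linear_slice_point)
  have z0: "z \<noteq> 0"
    using u by (auto simp: z_def complex_eq_iff)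
  define h where "h x = clifford_exp (x *\<^sub>R slice_point I u (v - \<xi>))" for x
  have h: "h x = \<phi> (exp (x *\<^sub>R z))" for x
    unfolding h_def scaleR_slice_point clifford_exp_slice_point[OF I] \<phi>_def z_def
    by (simp add: Re_exp Im_exp scaleR_slice_point)
  have cont: "isCont h x" for x
    unfolding h by (intro bounded_linear.isCont[OF bl] continuous_intros)
  then have [measurable]: "h \<in> borel_measurable borel"
    by (intro borel_measurable_continuous_onI) (simp add: continuous_at_imp_continuous_on)
  have int0: "set_integrable lborel {..0} h"
    using set_integrable_clifford_exp[OF I u, of "v - \<xi>"]
    unfolding set_integrable_def h_def[symmetric] by (subst (asm) integrable_completion) auto
  have ei: "einterval (-\<infinity>) 0 = {..<0}"
    by (auto simp: einterval_def zero_ereal_def)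
  have "(LBINT x=-\<infinity>..0. h x) = \<phi> (1 / z) - 0"
  proof (rule interval_integral_FTC_integrable[where F = "\<lambda>x. \<phi> (exp (x *\<^sub>R z) / z)"])
    show "((\<lambda>x. \<phi> (exp (x *\<^sub>R z) / z)) has_vector_derivative h x) (at x)" for x
    proof -
      have "((\<lambda>x. exp (x *\<^sub>R z) / z) has_vector_derivative exp (x *\<^sub>R z)) (at x)"
        using z0 unfolding scaleR_conv_of_real
        by (intro has_vector_derivative_real_field) (auto intro!: derivative_eq_intros)
      then show ?thesis
        unfolding h by (rule bounded_linear.has_vector_derivative[OF bl])
    qed
    show "set_integrable lborel (einterval (-\<infinity>) 0) h"
      unfolding ei by (rule set_integrable_subset[OF int0]) auto
    have "((\<lambda>x. exp (x *\<^sub>R z) / z) \<longlongrightarrow> 0) at_bot"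
    proof (rule Lim_null_comparison)
      show "\<forall>\<^sub>F x in at_bot. norm (exp (x *\<^sub>R z) / z) \<le> exp (u * x) / norm z"
        by (simp add: norm_divide z_def mult.commute)
      have "((\<lambda>x. exp (u * x)) \<longlongrightarrow> 0) at_bot"
        by (rule filterlim_compose[OF exp_at_bot])
          (use u in \<open>simp add: filterlim_tendsto_pos_mult_at_bot[OF tendsto_const] filterlim_ident\<close>)
      then show "((\<lambda>x. exp (u * x) / norm z) \<longlongrightarrow> 0) at_bot"
        by (rule tendsto_divide_zero)
    qed
    then have "((\<lambda>x. \<phi> (exp (x *\<^sub>R z) / z)) \<longlongrightarrow> \<phi> 0) at_bot"
      by (rule bounded_linear.tendsto[OF bl])
    moreover have "\<phi> 0 = 0"
      using bl by (simp add: bounded_linear.linear linear_0)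
    ultimately show "(((\<lambda>x. \<phi> (exp (x *\<^sub>R z) / z)) \<circ> real_of_ereal) \<longlongrightarrow> 0) (at_right (-\<infinity>))"
      by (simp add: ereal_tendsto_simps)
    have "isCont (\<lambda>x. \<phi> (exp (x *\<^sub>R z) / z)) 0"
      using z0 by (intro bounded_linear.isCont[OF bl] continuous_intros)
    then have "((\<lambda>x. \<phi> (exp (x *\<^sub>R z) / z)) \<longlongrightarrow> \<phi> (exp (0 *\<^sub>R z) / z)) (at_left 0)"
      by (simp only: isCont_def filterlim_at_split)
    then show "(((\<lambda>x. \<phi> (exp (x *\<^sub>R z) / z)) \<circ> real_of_ereal) \<longlongrightarrow> \<phi> (1 / z)) (at_left 0)"
      unfolding zero_ereal_def by (simp add: ereal_tendsto_simps)
  qed (use cont in auto)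
  \<comment> \<open>The interval integral runs over the open half line; the endpoint
    \<open>0\<close> is a null set.\<close>
  moreover have "(LBINT x=-\<infinity>..0. h x) = (LBINT x:{..0}. h x)"
  proof -
    have "(LBINT x=-\<infinity>..0. h x) = (LBINT x:{..<0}. h x)"
      by (simp add: interval_lebesgue_integral_def ei)
    also have "\<dots> = (LBINT x:{..0}. h x)"
      unfolding set_lebesgue_integral_def
      by (intro integral_cong_AE eventually_mono[OF AE_lborel_singleton[of 0]])
        (auto simp: indicator_def)
    finally show ?thesis .
  qed
  moreover have "(LINT x:{..0}|lebesgue. h x) = (LBINT x:{..0}. h x)"
    unfolding set_lebesgue_integral_def by (rule integral_completion) auto
  ultimately have "(LINT x:{..0}|lebesgue. h x) = \<phi> (1 / z)"
    by simp
  then have "half_plane_kernel I (slice_point I u v) 0 \<xi> = (1 / (2 * pi)) *\<^sub>R \<phi> (1 / z)"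
    by (simp add: half_plane_kernel_def slice_point_add h_def)
  also have "\<dots> = \<phi> ((1 / (2 * pi)) *\<^sub>R (1 / z))"
    using bl by (simp add: bounded_linear.linear linear_scale)
  also have "(1 / (2 * pi)) *\<^sub>R (1 / z) = 1 / (2 * pi * (Complex u v - Complex 0 \<xi>))"
    by (simp add: scaleR_conv_of_real z_def complex_diff)
  finally show ?thesis
    by (simp add: \<phi>_def Let_def)
qed

lemma has_bochner_integral_componentwise:
  fixes h :: "'a \<Rightarrow> 'b::euclidean_space"
  assumes "\<And>c. c \<in> Basis \<Longrightarrow> has_bochner_integral M (\<lambda>x. inner (h x) c) (inner y c)"
  shows "has_bochner_integral M h y"
proof -
  have "has_bochner_integral M (\<lambda>x. \<Sum>c\<in>Basis. inner (h x) c *\<^sub>R c) (\<Sum>c\<in>Basis. inner y c *\<^sub>R c)"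
    by (intro has_bochner_integral_sum has_bochner_integral_scaleR_left assms)
  then show ?thesis
    by (simp add: euclidean_representation)
qed

text \<open>Each coordinate is the real part of a complex component, under which the Clifford kernel
  turns into the complex Cauchy kernel.\<close>

lemma has_bochner_integral_half_plane_kernel:
  fixes f :: "'n::{finite,linorder} clifford \<Rightarrow> 'n clifford"
  assumes p: "1 \<le> p" "p \<le> 2" and f: "f \<in> hardy_slice p" and I: "I \<in> unit_sphere" and u: "0 < u"
  shows "has_bochner_integral lebesgue
    (\<lambda>\<xi>. half_plane_kernel I (slice_point I u v) 0 \<xi> * boundary_value f I \<xi>) (f (slice_point I u v))"
proof (rule has_bochner_integral_componentwise)
  fix c :: "'n clifford"
  let ?L = "complex_component I c"
  have L: "linear ?L" "?L (I * a) = \<i> * ?L a" for a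
    using I by (simp_all add: linear_complex_component complex_component_mult)
  have eq: "?L (half_plane_kernel I (slice_point I u v) 0 \<xi> * a)
      = ?L a / (2 * pi * (Complex u v - Complex 0 \<xi>))" for \<xi> a
    unfolding half_plane_kernel_eq[OF I u] Let_def linear_slice_point_mult[OF L] by simp
  have Re: "inner a c = Re (?L a)" for a
    by (simp add: complex_component_def)
  have "has_bochner_integral lebesgue (\<lambda>\<xi>. ?L (half_plane_kernel I (slice_point I u v) 0 \<xi> * boundary_value f I \<xi>))
      (?L (f (slice_point I u v)))"
    unfolding eq using has_bochner_integral_slice_component[OF p f I L, of "Complex u v"] u by simp
  then show "has_bochner_integral lebesgue
      (\<lambda>\<xi>. inner (half_plane_kernel I (slice_point I u v) 0 \<xi> * boundary_value f I \<xi>) c)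
      (inner (f (slice_point I u v)) c)"
    unfolding Re by (rule has_bochner_integral_Re)
qed

text \<open>
  Left multiplication by \<open>1 - J I\<close> intertwines \<open>I\<close> and \<open>J\<close>, and \<open>1 + J I\<close> intertwines \<open>- I\<close> and \<open>J\<close>.
  Both sides therefore become holomorphic under every \<open>complex_component J c\<close>, and they agree on the
  real axis.
\<close>

lemma representation_formula:
  fixes f :: "'n::{finite,linorder} clifford \<Rightarrow> 'n clifford"
  assumes f: "f \<in> slice_monogenic half_space" and I: "I \<in> unit_sphere" and J: "J \<in> unit_sphere"
    and u: "0 < u"
  shows "f (slice_point J u v) = (1 / 2) *\<^sub>R (f (slice_point I u (- v)) + f (slice_point I u v))
    + (1 / 2) *\<^sub>R (J * I * (f (slice_point I u (- v)) - f (slice_point I u v)))"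
proof (rule euclidean_eqI)
  fix c :: "'n clifford"
  let ?L = "complex_component J c"
  define L1 where "L1 a = ?L ((1 / 2) *\<^sub>R (a - J * I * a))" for a
  define L2 where "L2 a = ?L ((1 / 2) *\<^sub>R (a + J * I * a))" for a
  have I': "- I \<in> unit_sphere"
    using I by (rule uminus_unit_sphere)
  have L: "linear ?L" "?L (J * a) = \<i> * ?L a" for a
    using J by (simp_all add: linear_complex_component complex_component_mult)
  have lin: "linear (\<lambda>a. (1 / 2) *\<^sub>R (a - J * I * a))" "linear (\<lambda>a. (1 / 2) *\<^sub>R (a + J * I * a))"
    by (rule linearI; simp add: algebra_simps)+
  have lin1: "linear L1" and lin2: "linear L2"
    using linear_compose[OF lin(1) L(1)] linear_compose[OF lin(2) L(1)]
    by (simp_all add: o_def L1_def[abs_def] L2_def[abs_def])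
  have L1: "L1 (I * a) = \<i> * L1 a" for a
  proof -
    have "I * a - J * I * (I * a) = J * (a - J * I * a)"
      using unit_sphere_mult_cancel[OF I, of a] unit_sphere_mult_cancel[OF J, of "I * a"]
      by (simp add: mult.assoc right_diff_distrib)
    then show ?thesis
      unfolding L1_def by (simp flip: L(2))
  qed
  have L2: "L2 (- I * a) = \<i> * L2 a" for a
  proof -
    have "- I * a + J * I * (- I * a) = J * (a + J * I * a)"
      using unit_sphere_mult_cancel[OF I, of a] unit_sphere_mult_cancel[OF J, of "I * a"]
      by (simp add: mult.assoc distrib_left)
    then show ?thesis
      unfolding L2_def by (simp flip: L(2))
  qed
  \<comment> \<open>The last term lives on the slice of \<open>- I\<close>, where
    \<open>slice_point (- I) u v = slice_point I u (- v)\<close>; this avoids conjugating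
    \<open>z\<close> and keeps \<open>d\<close> holomorphic.\<close>
  define d where "d z = ?L (f (slice_point J (Re z) (Im z))) - L1 (f (slice_point I (Re z) (Im z)))
      - L2 (f (slice_point (- I) (Re z) (Im z)))" for z
  have "d (Complex u v) = 0"
  proof (rule analytic_continuation[where f = d and S = "{z. 0 < Re z}" and U = "of_real ` {0<..}" and \<xi> = 1])
    show "d holomorphic_on {z. 0 < Re z}"
      unfolding d_def
      by (intro holomorphic_intros holomorphic_slice_component[OF f J L]
          holomorphic_slice_component[OF f I lin1 L1] holomorphic_slice_component[OF f I' lin2 L2])
    show "connected {z. 0 < Re z}"
      by (intro convex_connected convex_halfspace_Re_gt)
    show "of_real ` {0<..} \<subseteq> {z. 0 < Re z}"
      by auto
    show "(1 :: complex) islimpt of_real ` {0<..}"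
      unfolding islimpt_approachable
    proof (intro allI impI)
      fix e :: real
      assume "0 < e"
      then show "\<exists>x\<in>of_real ` {0<..}. x \<noteq> 1 \<and> dist x (1 :: complex) < e"
        by (intro bexI[of _ "of_real (1 + e / 2)"] imageI) (auto simp: dist_norm)
    qed
    show "d z = 0" if "z \<in> of_real ` {0<..}" for z
    proof -
      from that obtain r where z: "z = of_real r"
        by auto
      have "slice_point K r 0 = of_real r" for K :: "'n clifford"
        by (simp add: slice_point_def)
      moreover have "?L a = L1 a + L2 a" for a
      proof -
        have "a = (1 / 2) *\<^sub>R (a - J * I * a) + (1 / 2) *\<^sub>R (a + J * I * a)"
          by (rule clifford_eqI) (simp add: field_simps)
        then show ?thesis
          unfolding L1_def L2_def linear_add[OF L(1), symmetric] by simp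
      qed
      ultimately show ?thesis
        by (simp add: d_def z)
    qed
  qed (use u in \<open>auto simp: open_halfspace_Re_gt\<close>)
  then have "?L (f (slice_point J u v)) = L1 (f (slice_point I u v)) + L2 (f (slice_point I u (- v)))"
    by (simp add: d_def slice_point_def diff_eq_eq add.commute)
  also have "\<dots> = ?L ((1 / 2) *\<^sub>R (f (slice_point I u (- v)) + f (slice_point I u v))
    + (1 / 2) *\<^sub>R (J * I * (f (slice_point I u (- v)) - f (slice_point I u v))))"
    unfolding L1_def L2_def linear_add[OF L(1), symmetric]
    by (rule arg_cong[where f = ?L]) (simp add: algebra_simps)
  finally show "inner (f (slice_point J u v)) c
    = inner ((1 / 2) *\<^sub>R (f (slice_point I u (- v)) + f (slice_point I u v))
      + (1 / 2) *\<^sub>R (J * I * (f (slice_point I u (- v)) - f (slice_point I u v)))) c"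
    by (simp only: complex_component_def complex.inject)
qed

theorem corollary3p11:
  fixes f :: "'n::{finite,linorder} clifford \<Rightarrow> 'n clifford"
    and p :: real
    and I x :: "'n clifford"
  assumes "1 \<le> p" and "p \<le> 2"
    and "f \<in> hardy_slice p"
    and "I \<in> unit_sphere"
    and "x \<in> half_space"
  shows "integrable lebesgue (\<lambda>\<xi>. half_space_kernel I x 0 \<xi> * boundary_value f I \<xi>)
    \<and> f x = (LINT \<xi>|lebesgue. half_space_kernel I x 0 \<xi> * boundary_value f I \<xi>)"
proof -
  obtain J u v where x: "x = slice_point J u v" and J: "J \<in> unit_sphere" and u: "0 < u"
    using assms(5) by (auto simp: half_space_def)
  define k where "k t \<xi> = half_plane_kernel I (slice_point I u t) 0 \<xi> * boundary_value f I \<xi>" for t \<xi>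
  have k: "has_bochner_integral lebesgue (k t) (f (slice_point I u t))" for t
    unfolding k_def by (rule has_bochner_integral_half_plane_kernel[OF assms(1-4) u])
  \<comment> \<open>The extension acts by left multiplications only, so it commutes with multiplying
    the kernel by the boundary value on the right.\<close>
  have "half_space_kernel I x 0 \<xi> * boundary_value f I \<xi>
      = (1 / 2) *\<^sub>R (k (- v) \<xi> + k v \<xi>) + (1 / 2) *\<^sub>R (J * I * (k (- v) \<xi> - k v \<xi>))" for \<xi>
    unfolding half_space_kernel_def x slice_extension_slice_point[OF J] k_def
    by (simp add: distrib_right left_diff_distrib right_diff_distrib mult.assoc)
  moreover have "has_bochner_integral lebesgue
      (\<lambda>\<xi>. (1 / 2) *\<^sub>R (k (- v) \<xi> + k v \<xi>) + (1 / 2) *\<^sub>R (J * I * (k (- v) \<xi> - k v \<xi>))) (f x)"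
    unfolding x representation_formula[OF _ assms(4) J u, of f v, OF assms(3)[unfolded hardy_slice_def, THEN CollectD, THEN conjunct1]]
    by (intro has_bochner_integral_add has_bochner_integral_scaleR_right has_bochner_integral_diff k
        has_bochner_integral_bounded_linear[OF bounded_linear_clifford_mult])
  ultimately show ?thesis
    by (simp add: has_bochner_integral_iff)
qed

end
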